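(* Let $(M,\varphi,\xi,\eta,g)$ be an almost contact B-metric manifold with Levi-Civita connection $\nabla$ of $g$, and let $D$ be the Schouten-van Kampen connection associated to $\nabla$ and adapted to $(\mathcal{H},\mathcal{V})$. Then $D$ coincides with $\nabla$ if and only if $(M,\varphi,\xi,\eta,g)$ belongs to the class $\mathcal{U}_1=\mathcal{F}_1\oplus\mathcal{F}_2\oplus\mathcal{F}_3\oplus\mathcal{F}_{10}$.
   Context: An almost contact B-metric manifold $(M,\varphi,\xi,\eta,g)$ is a smooth $(2n+1)$-dimensional manifold ($n\ge 1$) with an endomorphism $\varphi$ of $TM$, a vector field $\xi$, a 1-form $\eta$ and a pseudo-Riemannian metric $g$ of signature $(n+1,n)$ such that $\varphi\xi=0$, $\varphi^2=-\mathrm{Id}+\eta\otimes\xi$, $\eta\circ\varphi=0$, $\eta(\xi)=1$, and $g(\varphi x,\varphi y)=-g(x,y)+\eta(x)\eta(y)$. Put $\mathcal{H}=\ker\eta$, $\mathcal{V}=\mathrm{span}(\xi)$, $x^h=x-\eta(x)\xi$, $x^v=\eta(x)\xi$. The Schouten-van Kampen connection associated to $\nabla$ and adapted to $(\mathcal{H},\mathcal{V})$ is $D_xy=(\nabla_xy^h)^h+(\nabla_xy^v)^v$. Classes: let $F(x,y,z)=g((\nabla_x\varphi)y,z)$. At each point $F$ lies in the vector space of $(0,3)$-tensors satisfying $F(x,y,z)=F(x,z,y)=F(x,\varphi y,\varphi z)+\eta(y)F(x,\xi,z)+\eta(z)F(x,y,\xi)$. Let $\theta(z)=g^{ij}F(e_i,e_j,z)$,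 where $\{e_1,\dots,e_{2n}\}$ is a basis of $\ker\eta$ at the point and $(g^{ij})$ is the inverse of $(g(e_i,e_j))$; $\mathfrak{S}_{x,y,z}$ denotes the cyclic sum over $x,y,z$. Each of the following conditions (for all $x,y,z$) defines a linear subspace, called a basic class: - $\mathcal{F}_1$: $F(x,y,z)=\frac{1}{2n}\{g(x,\varphi y)\theta(\varphi z)+g(\varphi x,\varphi y)\theta(\varphi^2z)+g(x,\varphi z)\theta(\varphi y)+g(\varphi x,\varphi z)\theta(\varphi^2y)\}$; - $\mathcal{F}_2$: $F(\xi,y,z)=F(x,\xi,z)=0$, $\mathfrak{S}_{x,y,z}F(x,y,\varphi z)=0$, $\theta=0$; - $\mathcal{F}_3$: $F(\xi,y,z)=F(x,\xi,z)=0$, $\mathfrak{S}_{x,y,z}F(x,y,z)=0$; - $\mathcal{F}_{10}$: $F(x,y,z)=F(\xi,\varphi y,\varphi z)\eta(x)$. A manifold belongs to a direct sum of basic classes if at every point $F$ lies in the direct sum of the corresponding subspaces. *)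

theory Defs
  imports "HOL-Analysis.Analysis" "HOL-Library.Function_Algebras"
begin

text \<open>Pointwise real vector space structure on functions; tangent vectors (functionals on
  smooth functions) and tensors at a point are elements of such function spaces.\<close>

instantiation "fun" :: (type, real_vector) real_vector
begin

definition scaleR_fun :: "real \<Rightarrow> ('a \<Rightarrow> 'b) \<Rightarrow> 'a \<Rightarrow> 'b"
  where "scaleR_fun c f = (\<lambda>x. c *\<^sub>R f x)"

instance
  by standard (simp_all add: scaleR_fun_def fun_eq_iff algebra_simps)

end

section \<open>Smooth manifolds\<close>

text \<open>To be used for open \<open>S\<close> only: all derivatives are two-sided.\<close>

fun Ck_on :: "nat \<Rightarrow> 'e::euclidean_space set \<Rightarrow> ('e \<Rightarrow> 'f::real_normed_vector) \<Rightarrow> bool" where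
  "Ck_on 0 S f \<longleftrightarrow> continuous_on S f"
| "Ck_on (Suc k) S f \<longleftrightarrow> (\<forall>x\<in>S. f differentiable (at x)) \<and>
     (\<forall>v. Ck_on k S (\<lambda>x. frechet_derivative f (at x) v))"

definition smooth_on :: "'e::euclidean_space set \<Rightarrow> ('e \<Rightarrow> 'f::real_normed_vector) \<Rightarrow> bool"
  where "smooth_on S f \<longleftrightarrow> (\<forall>k. Ck_on k S f)"

text \<open>The manifold is the whole type \<open>'a\<close>. A chart \<open>(U, c)\<close> has domain \<open>U\<close>; the values
  of \<open>c\<close> outside \<open>U\<close> are irrelevant.\<close>

type_synonym ('a, 'e) chart = "'a set \<times> ('a \<Rightarrow> 'e)"

locale smooth_manifold =
  fixes A :: "('a::{t2_space,second_countable_topology}, 'e::euclidean_space) chart set"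
  assumes charts_cover: "(\<Union>(U, c)\<in>A. U) = UNIV"
    and charts_homeomorphism: "(U, c) \<in> A \<Longrightarrow>
      open U \<and> open (c ` U) \<and> homeomorphism U (c ` U) c (inv_into U c)"
    and charts_compatible: "(U, c) \<in> A \<Longrightarrow> (V, d) \<in> A \<Longrightarrow>
      smooth_on (c ` (U \<inter> V)) (d \<circ> inv_into U c)"

definition smooth_functions :: "('a, 'e::euclidean_space) chart set \<Rightarrow> ('a \<Rightarrow> real) set"
  where "smooth_functions A = {f. \<forall>(U, c)\<in>A. smooth_on (c ` U) (f \<circ> inv_into U c)}"

type_synonym 'a tvec = "('a \<Rightarrow> real) \<Rightarrow> real"
type_synonym 'a vfield = "'a \<Rightarrow> 'a tvec"

text \<open>Derivations at \<open>p\<close> of the algebra of smooth functions. The last conjunct makes a tangent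
  vector, as a HOL function, determined by its values on smooth functions.\<close>

definition tangent_space :: "('a, 'e::euclidean_space) chart set \<Rightarrow> 'a \<Rightarrow> 'a tvec set"
  where "tangent_space A p = {v.
    (\<forall>f\<in>smooth_functions A. \<forall>h\<in>smooth_functions A. v (\<lambda>q. f q + h q) = v f + v h) \<and>
    (\<forall>a. \<forall>f\<in>smooth_functions A. v (\<lambda>q. a * f q) = a * v f) \<and>
    (\<forall>f\<in>smooth_functions A. \<forall>h\<in>smooth_functions A.
        v (\<lambda>q. f q * h q) = f p * v h + h p * v f) \<and>
    (\<forall>f. f \<notin> smooth_functions A \<longrightarrow> v f = 0)}"

definition vector_fields :: "('a, 'e::euclidean_space) chart set \<Rightarrow> 'a vfield set"
  where "vector_fields A = {X. (\<forall>p. X p \<in> tangent_space A p) \<and>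
    (\<forall>f\<in>smooth_functions A. (\<lambda>p. X p f) \<in> smooth_functions A)}"

definition lie_bracket :: "'a vfield \<Rightarrow> 'a vfield \<Rightarrow> 'a vfield"
  where "lie_bracket X Y = (\<lambda>p f. X p (\<lambda>q. Y q f) - Y p (\<lambda>q. X q f))"

definition linear_on :: "'v::real_vector set \<Rightarrow> ('v \<Rightarrow> 'w::real_vector) \<Rightarrow> bool"
  where "linear_on V f \<longleftrightarrow> (\<forall>x\<in>V. \<forall>y\<in>V. f (x + y) = f x + f y) \<and>
    (\<forall>a. \<forall>x\<in>V. f (a *\<^sub>R x) = a *\<^sub>R f x)"

definition symmetric_bilinear_on :: "'v::real_vector set \<Rightarrow> ('v \<Rightarrow> 'v \<Rightarrow> real) \<Rightarrow> bool"
  where "symmetric_bilinear_on V b \<longleftrightarrow>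
    (\<forall>x\<in>V. linear_on V (b x)) \<and> (\<forall>x\<in>V. \<forall>y\<in>V. b x y = b y x)"

text \<open>\<open>b\<close> has \<open>r\<close> positive and \<open>s\<close> negative squares: \<open>P \<union> N\<close> is an orthonormal basis.\<close>

definition has_signature ::
  "'v::real_vector set \<Rightarrow> ('v \<Rightarrow> 'v \<Rightarrow> real) \<Rightarrow> nat \<Rightarrow> nat \<Rightarrow> bool"
  where "has_signature V b r s \<longleftrightarrow> (\<exists>P N. finite P \<and> finite N \<and> card P = r \<and> card N = s \<and>
    P \<inter> N = {} \<and> independent (P \<union> N) \<and> span (P \<union> N) = V \<and>
    (\<forall>x\<in>P. b x x = 1) \<and> (\<forall>x\<in>N. b x x = -1) \<and>
    (\<forall>x\<in>P \<union> N. \<forall>y\<in>P \<union> N. x \<noteq> y \<longrightarrow> b x y = 0))"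

locale almost_contact_B_metric_manifold = smooth_manifold A
  for A :: "('a::{t2_space,second_countable_topology}, 'e::euclidean_space) chart set" +
  fixes n :: nat
    and \<phi> :: "'a \<Rightarrow> 'a tvec \<Rightarrow> 'a tvec"
    and \<xi> :: "'a vfield"
    and \<eta> :: "'a \<Rightarrow> 'a tvec \<Rightarrow> real"
    and g :: "'a \<Rightarrow> 'a tvec \<Rightarrow> 'a tvec \<Rightarrow> real"
  assumes n_ge_1: "n \<ge> 1"
    and dimension: "DIM('e) = 2 * n + 1"
    and phi_linear: "linear_on (tangent_space A p) (\<phi> p)"
    and phi_smooth: "X \<in> vector_fields A \<Longrightarrow> (\<lambda>p. \<phi> p (X p)) \<in> vector_fields A"
    and phi_tangent: "x \<in> tangent_space A p \<Longrightarrow> \<phi> p x \<in> tangent_space A p"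
    and xi_smooth: "\<xi> \<in> vector_fields A"
    and eta_linear: "linear_on (tangent_space A p) (\<eta> p)"
    and eta_smooth: "X \<in> vector_fields A \<Longrightarrow> (\<lambda>p. \<eta> p (X p)) \<in> smooth_functions A"
    and g_bilinear: "symmetric_bilinear_on (tangent_space A p) (g p)"
    and g_signature: "has_signature (tangent_space A p) (g p) (n + 1) n"
    and g_smooth: "X \<in> vector_fields A \<Longrightarrow> Y \<in> vector_fields A \<Longrightarrow>
      (\<lambda>p. g p (X p) (Y p)) \<in> smooth_functions A"
    and phi_xi: "\<phi> p (\<xi> p) = 0"
    and phi_phi: "x \<in> tangent_space A p \<Longrightarrow> \<phi> p (\<phi> p x) = - x + \<eta> p x *\<^sub>R \<xi> p"
    and eta_phi: "x \<in> tangent_space A p \<Longrightarrow> \<eta> p (\<phi> p x) = 0"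
    and eta_xi: "\<eta> p (\<xi> p) = 1"
    and g_phi_phi: "x \<in> tangent_space A p \<Longrightarrow> y \<in> tangent_space A p \<Longrightarrow>
      g p (\<phi> p x) (\<phi> p y) = - g p x y + \<eta> p x * \<eta> p y"

section \<open>Connections\<close>

definition is_connection ::
  "('a, 'e::euclidean_space) chart set \<Rightarrow> ('a vfield \<Rightarrow> 'a vfield \<Rightarrow> 'a vfield) \<Rightarrow> bool"
  where "is_connection A nabla \<longleftrightarrow>
    (\<forall>X\<in>vector_fields A. \<forall>Y\<in>vector_fields A. nabla X Y \<in> vector_fields A) \<and>
    (\<forall>X\<in>vector_fields A. \<forall>Y\<in>vector_fields A. \<forall>Z\<in>vector_fields A.
        nabla (X + Y) Z = nabla X Z + nabla Y Z \<and> nabla X (Y + Z) = nabla X Y + nabla X Z) \<and>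
    (\<forall>f\<in>smooth_functions A. \<forall>X\<in>vector_fields A. \<forall>Y\<in>vector_fields A.
        nabla (\<lambda>p. f p *\<^sub>R X p) Y = (\<lambda>p. f p *\<^sub>R nabla X Y p) \<and>
        nabla X (\<lambda>p. f p *\<^sub>R Y p) = (\<lambda>p. X p f *\<^sub>R Y p + f p *\<^sub>R nabla X Y p))"

definition is_levi_civita ::
  "('a, 'e::euclidean_space) chart set \<Rightarrow> ('a \<Rightarrow> 'a tvec \<Rightarrow> 'a tvec \<Rightarrow> real) \<Rightarrow>
   ('a vfield \<Rightarrow> 'a vfield \<Rightarrow> 'a vfield) \<Rightarrow> bool"
  where "is_levi_civita A g nabla \<longleftrightarrow> is_connection A nabla \<and>
    (\<forall>X\<in>vector_fields A. \<forall>Y\<in>vector_fields A. nabla X Y - nabla Y X = lie_bracket X Y) \<and>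
    (\<forall>X\<in>vector_fields A. \<forall>Y\<in>vector_fields A. \<forall>Z\<in>vector_fields A. \<forall>p.
        X p (\<lambda>q. g q (Y q) (Z q)) = g p (nabla X Y p) (Z p) + g p (Y p) (nabla X Z p))"

definition horizontal :: "'a vfield \<Rightarrow> ('a \<Rightarrow> 'a tvec \<Rightarrow> real) \<Rightarrow> 'a vfield \<Rightarrow> 'a vfield"
  where "horizontal \<xi> \<eta> X = (\<lambda>p. X p - \<eta> p (X p) *\<^sub>R \<xi> p)"

definition vertical :: "'a vfield \<Rightarrow> ('a \<Rightarrow> 'a tvec \<Rightarrow> real) \<Rightarrow> 'a vfield \<Rightarrow> 'a vfield"
  where "vertical \<xi> \<eta> X = (\<lambda>p. \<eta> p (X p) *\<^sub>R \<xi> p)"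

definition schouten_van_kampen ::
  "'a vfield \<Rightarrow> ('a \<Rightarrow> 'a tvec \<Rightarrow> real) \<Rightarrow> ('a vfield \<Rightarrow> 'a vfield \<Rightarrow> 'a vfield) \<Rightarrow>
   'a vfield \<Rightarrow> 'a vfield \<Rightarrow> 'a vfield"
  where "schouten_van_kampen \<xi> \<eta> nabla X Y =
    horizontal \<xi> \<eta> (nabla X (horizontal \<xi> \<eta> Y)) + vertical \<xi> \<eta> (nabla X (vertical \<xi> \<eta> Y))"

section \<open>The fundamental tensor\<close>

definition cov_deriv_phi ::
  "('a vfield \<Rightarrow> 'a vfield \<Rightarrow> 'a vfield) \<Rightarrow> ('a \<Rightarrow> 'a tvec \<Rightarrow> 'a tvec) \<Rightarrow>
   'a vfield \<Rightarrow> 'a vfield \<Rightarrow> 'a vfield"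
  where "cov_deriv_phi nabla \<phi> X Y =
    nabla X (\<lambda>p. \<phi> p (Y p)) - (\<lambda>p. \<phi> p (nabla X Y p))"

definition extension :: "('a, 'e::euclidean_space) chart set \<Rightarrow> 'a \<Rightarrow> 'a tvec \<Rightarrow> 'a vfield"
  where "extension A p v = (SOME X. X \<in> vector_fields A \<and> X p = v)"

text \<open>\<open>F\<close> at the point \<open>p\<close>. Since \<open>\<nabla>\<phi>\<close> is tensorial, the value does not depend on the chosen
  extensions of \<open>x\<close> and \<open>y\<close> to vector fields. Tensors at \<open>p\<close> are set to zero outside the
  tangent space, so that equality of tensors is equality of HOL functions.\<close>

definition fundamental_tensor ::
  "('a, 'e::euclidean_space) chart set \<Rightarrow> ('a \<Rightarrow> 'a tvec \<Rightarrow> 'a tvec) \<Rightarrow>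
   ('a \<Rightarrow> 'a tvec \<Rightarrow> 'a tvec \<Rightarrow> real) \<Rightarrow> ('a vfield \<Rightarrow> 'a vfield \<Rightarrow> 'a vfield) \<Rightarrow>
   'a \<Rightarrow> 'a tvec \<Rightarrow> 'a tvec \<Rightarrow> 'a tvec \<Rightarrow> real"
  where "fundamental_tensor A \<phi> g nabla p x y z =
    (if x \<in> tangent_space A p \<and> y \<in> tangent_space A p \<and> z \<in> tangent_space A p
     then g p (cov_deriv_phi nabla \<phi> (extension A p x) (extension A p y) p) z else 0)"

section \<open>Basic classes at a point\<close>

text \<open>In this section \<open>V\<close> is the tangent space at a point and \<open>\<phi>\<close>, \<open>\<xi>\<close>, \<open>\<eta>\<close>, \<open>g\<close> are the
  values of the structure tensors at that point.\<close>

definition tensors03 :: "'v::real_vector set \<Rightarrow> ('v \<Rightarrow> 'v \<Rightarrow> 'v \<Rightarrow> real) set"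
  where "tensors03 V = {F.
    (\<forall>x\<in>V. \<forall>y\<in>V. linear_on V (\<lambda>z. F x y z)) \<and>
    (\<forall>x\<in>V. \<forall>z\<in>V. linear_on V (\<lambda>y. F x y z)) \<and>
    (\<forall>y\<in>V. \<forall>z\<in>V. linear_on V (\<lambda>x. F x y z)) \<and>
    (\<forall>x y z. \<not> (x \<in> V \<and> y \<in> V \<and> z \<in> V) \<longrightarrow> F x y z = 0)}"

definition F_tensors ::
  "'v::real_vector set \<Rightarrow> ('v \<Rightarrow> 'v) \<Rightarrow> 'v \<Rightarrow> ('v \<Rightarrow> real) \<Rightarrow> ('v \<Rightarrow> 'v \<Rightarrow> 'v \<Rightarrow> real) set"
  where "F_tensors V \<phi> \<xi> \<eta> = {F \<in> tensors03 V. \<forall>x\<in>V. \<forall>y\<in>V. \<forall>z\<in>V.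
    F x y z = F x z y \<and>
    F x y z = F x (\<phi> y) (\<phi> z) + \<eta> y * F x \<xi> z + \<eta> z * F x y \<xi>}"

text \<open>A basis of \<open>H\<close> is used as its own index set, so \<open>h u w\<close> is the entry \<open>g\<^sup>u\<^sup>w\<close> of the
  inverse Gram matrix. The trace does not depend on the chosen basis.\<close>

definition inverse_gram :: "('v \<Rightarrow> 'v \<Rightarrow> real) \<Rightarrow> 'v set \<Rightarrow> ('v \<Rightarrow> 'v \<Rightarrow> real) \<Rightarrow> bool"
  where "inverse_gram g B h \<longleftrightarrow>
    (\<forall>u\<in>B. \<forall>w\<in>B. (\<Sum>t\<in>B. h u t * g t w) = (if u = w then 1 else 0))"

definition lee_form ::
  "'v::real_vector set \<Rightarrow> ('v \<Rightarrow> real) \<Rightarrow> ('v \<Rightarrow> 'v \<Rightarrow> real) \<Rightarrow>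
   ('v \<Rightarrow> 'v \<Rightarrow> 'v \<Rightarrow> real) \<Rightarrow> 'v \<Rightarrow> real"
  where "lee_form V \<eta> g F z =
    (let B = (SOME B. independent B \<and> span B = {x \<in> V. \<eta> x = 0});
         h = (SOME h. inverse_gram g B h)
     in \<Sum>u\<in>B. \<Sum>w\<in>B. h u w * F u w z)"

definition class_F1 ::
  "'v::real_vector set \<Rightarrow> nat \<Rightarrow> ('v \<Rightarrow> 'v) \<Rightarrow> 'v \<Rightarrow> ('v \<Rightarrow> real) \<Rightarrow> ('v \<Rightarrow> 'v \<Rightarrow> real) \<Rightarrow>
   ('v \<Rightarrow> 'v \<Rightarrow> 'v \<Rightarrow> real) set"
  where "class_F1 V n \<phi> \<xi> \<eta> g = {F \<in> F_tensors V \<phi> \<xi> \<eta>.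
    let \<theta> = lee_form V \<eta> g F in
    \<forall>x\<in>V. \<forall>y\<in>V. \<forall>z\<in>V. F x y z = 1 / (2 * real n) *
      (g x (\<phi> y) * \<theta> (\<phi> z) + g (\<phi> x) (\<phi> y) * \<theta> (\<phi> (\<phi> z)) +
       g x (\<phi> z) * \<theta> (\<phi> y) + g (\<phi> x) (\<phi> z) * \<theta> (\<phi> (\<phi> y)))}"

definition class_F2 ::
  "'v::real_vector set \<Rightarrow> ('v \<Rightarrow> 'v) \<Rightarrow> 'v \<Rightarrow> ('v \<Rightarrow> real) \<Rightarrow> ('v \<Rightarrow> 'v \<Rightarrow> real) \<Rightarrow>
   ('v \<Rightarrow> 'v \<Rightarrow> 'v \<Rightarrow> real) set"
  where "class_F2 V \<phi> \<xi> \<eta> g = {F \<in> F_tensors V \<phi> \<xi> \<eta>.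
    (\<forall>y\<in>V. \<forall>z\<in>V. F \<xi> y z = 0) \<and> (\<forall>x\<in>V. \<forall>z\<in>V. F x \<xi> z = 0) \<and>
    (\<forall>x\<in>V. \<forall>y\<in>V. \<forall>z\<in>V. F x y (\<phi> z) + F y z (\<phi> x) + F z x (\<phi> y) = 0) \<and>
    (\<forall>z\<in>V. lee_form V \<eta> g F z = 0)}"

definition class_F3 ::
  "'v::real_vector set \<Rightarrow> ('v \<Rightarrow> 'v) \<Rightarrow> 'v \<Rightarrow> ('v \<Rightarrow> real) \<Rightarrow>
   ('v \<Rightarrow> 'v \<Rightarrow> 'v \<Rightarrow> real) set"
  where "class_F3 V \<phi> \<xi> \<eta> = {F \<in> F_tensors V \<phi> \<xi> \<eta>.
    (\<forall>y\<in>V. \<forall>z\<in>V. F \<xi> y z = 0) \<and> (\<forall>x\<in>V. \<forall>z\<in>V. F x \<xi> z = 0) \<and>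
    (\<forall>x\<in>V. \<forall>y\<in>V. \<forall>z\<in>V. F x y z + F y z x + F z x y = 0)}"

definition class_F10 ::
  "'v::real_vector set \<Rightarrow> ('v \<Rightarrow> 'v) \<Rightarrow> 'v \<Rightarrow> ('v \<Rightarrow> real) \<Rightarrow>
   ('v \<Rightarrow> 'v \<Rightarrow> 'v \<Rightarrow> real) set"
  where "class_F10 V \<phi> \<xi> \<eta> = {F \<in> F_tensors V \<phi> \<xi> \<eta>.
    \<forall>x\<in>V. \<forall>y\<in>V. \<forall>z\<in>V. F x y z = F \<xi> (\<phi> y) (\<phi> z) * \<eta> x}"

text \<open>The basic classes are known to be linearly independent subspaces, so their direct sum is
  their sum.\<close>

definition class_U1 ::
  "'v::real_vector set \<Rightarrow> nat \<Rightarrow> ('v \<Rightarrow> 'v) \<Rightarrow> 'v \<Rightarrow> ('v \<Rightarrow> real) \<Rightarrow> ('v \<Rightarrow> 'v \<Rightarrow> real) \<Rightarrow>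
   ('v \<Rightarrow> 'v \<Rightarrow> 'v \<Rightarrow> real) set"
  where "class_U1 V n \<phi> \<xi> \<eta> g = {F1 + F2 + F3 + F10 | F1 F2 F3 F10.
    F1 \<in> class_F1 V n \<phi> \<xi> \<eta> g \<and> F2 \<in> class_F2 V \<phi> \<xi> \<eta> g \<and>
    F3 \<in> class_F3 V \<phi> \<xi> \<eta> \<and> F10 \<in> class_F10 V \<phi> \<xi> \<eta>}"

definition belongs_to_U1 ::
  "('a, 'e::euclidean_space) chart set \<Rightarrow> nat \<Rightarrow> ('a \<Rightarrow> 'a tvec \<Rightarrow> 'a tvec) \<Rightarrow> 'a vfield \<Rightarrow>
   ('a \<Rightarrow> 'a tvec \<Rightarrow> real) \<Rightarrow> ('a \<Rightarrow> 'a tvec \<Rightarrow> 'a tvec \<Rightarrow> real) \<Rightarrow>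
   ('a vfield \<Rightarrow> 'a vfield \<Rightarrow> 'a vfield) \<Rightarrow> bool"
  where "belongs_to_U1 A n \<phi> \<xi> \<eta> g nabla \<longleftrightarrow> (\<forall>p.
    fundamental_tensor A \<phi> g nabla p \<in> class_U1 (tangent_space A p) n (\<phi> p) (\<xi> p) (\<eta> p) (g p))"

end

theory Submission
  imports Defs
begin

text \<open>Both conditions say that \<open>\<nabla>\<xi> = 0\<close>.

  For the left hand side, \<open>g(\<xi>, \<xi>) = 1\<close> makes \<open>\<nabla>\<^sub>X\<xi>\<close> horizontal, so \<open>D\<^sub>X\<xi> = (\<nabla>\<^sub>X\<xi>)\<^sup>v = 0\<close>, and
  \<open>D = \<nabla>\<close> forces \<open>\<nabla>\<xi> = 0\<close>. Conversely \<open>\<eta> = g(\<cdot>, \<xi>)\<close>, so a parallel \<open>\<xi>\<close> makes \<open>\<nabla>\<close> preserve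
  both distributions, and then the projections in \<open>D\<close> do nothing
  (\<open>schouten_van_kampen_eq_iff\<close>).

  For the right hand side, \<open>\<phi>\<xi> = 0\<close> gives \<open>F(x, \<xi>, z) = - g(\<phi>\<nabla>\<^sub>x\<xi>, z)\<close>. As \<open>\<nabla>\<^sub>x\<xi>\<close> is horizontal,
  \<open>\<phi>\<close> is injective on the horizontal space and \<open>g\<close> is nondegenerate, \<open>\<nabla>\<xi> = 0\<close> holds if and
  only if \<open>F(x, \<xi>, z) = 0\<close> for all \<open>x\<close> and \<open>z\<close> (\<open>nabla_xi_zero_iff\<close>). That this describes the
  class \<open>\<F>\<^sub>1 \<oplus> \<F>\<^sub>2 \<oplus> \<F>\<^sub>3 \<oplus> \<F>\<^sub>1\<^sub>0\<close> is linear algebra at one point (\<open>class_U1_iff\<close>). Each of the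
  four classes satisfies the condition. Conversely, \<open>\<eta>(x) F(\<xi>, y, z)\<close> is the \<open>\<F>\<^sub>1\<^sub>0\<close> part of
  such an \<open>F\<close>, and what remains lives on \<open>H = ker \<eta>\<close>. There \<open>\<phi>\<close> is a complex structure, the
  complexified remainder has only components of mixed type in \<open>(y, z)\<close>, and \<open>x\<close> has the type of
  one of the two; the part antisymmetric in these two arguments is the \<open>\<F>\<^sub>3\<close> part, the
  symmetric part lies in \<open>\<F>\<^sub>1 \<oplus> \<F>\<^sub>2\<close> (\<open>horizontal_decomposition\<close>) and is split by its trace
  (\<open>F1_F2_decomposition\<close>). That the \<open>\<F>\<^sub>1\<close> tensor built from a given Lee form has this Lee form
  uses that \<open>\<phi>\<close> is trace-free on \<open>H\<close>.

  To connect the two levels, \<open>F\<close> must be known to be a tensor, although it is defined through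
  chosen extensions of tangent vectors to vector fields. This rests on frames: near each point
  there are global vector fields, cut off by a bump function, in which every tangent vector can
  be expanded with coefficients that depend smoothly on the vector (\<open>local_frame\<close>). Tangent
  vectors are derivations; the coordinate derivations are independent, and they span the tangent
  space because the signature of \<open>g\<close> fixes its dimension.\<close>

section \<open>Calculus of smooth functions\<close>

lemma Ck_on_SucD:
  assumes "Ck_on (Suc k) S f" "x \<in> S"
  shows "(f has_derivative frechet_derivative f (at x)) (at x)"
  using assms by (simp add: frechet_derivative_works)

lemma Ck_on_Suc_imp: "Ck_on (Suc k) S f \<Longrightarrow> Ck_on k S f"
proof (induction k arbitrary: f)
  case 0
  then show ?case
    by (auto intro!: differentiable_imp_continuous_on differentiable_at_imp_differentiable_on)
qed auto

lemma Ck_on_subset: "Ck_on k T f \<Longrightarrow> S \<subseteq> T \<Longrightarrow> Ck_on k S f"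
  by (induction k arbitrary: f) (auto intro: continuous_on_subset)

lemma Ck_on_cong:
  assumes "open S" "\<And>x. x \<in> S \<Longrightarrow> f x = h x" "Ck_on k S f"
  shows "Ck_on k S h"
  using assms(2,3)
proof (induction k arbitrary: f h)
  case 0
  then show ?case by (simp cong: continuous_on_cong)
next
  case (Suc k)
  have d: "(h has_derivative frechet_derivative f (at x)) (at x)" if "x \<in> S" for x
    using has_derivative_transform_within_open[OF Ck_on_SucD[OF Suc.prems(2) that] assms(1) that]
      Suc.prems(1) by blast
  have "Ck_on k S (\<lambda>x. frechet_derivative h (at x) v)" for v
  proof (rule Suc.IH)
    show "Ck_on k S (\<lambda>x. frechet_derivative f (at x) v)" using Suc.prems(2) by simp
    show "frechet_derivative f (at x) v = frechet_derivative h (at x) v" if "x \<in> S" for x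
      using frechet_derivative_at[OF d[OF that]] by simp
  qed
  then show ?case using d by (auto simp: differentiable_def)
qed

lemma Ck_on_SucI:
  assumes "open S" "\<And>x. x \<in> S \<Longrightarrow> (f has_derivative D x) (at x)"
    and "\<And>v. Ck_on k S (\<lambda>x. D x v)"
  shows "Ck_on (Suc k) S f"
proof -
  have "Ck_on k S (\<lambda>x. frechet_derivative f (at x) v)" for v
    by (rule Ck_on_cong[OF assms(1) _ assms(3)[of v]]) (metis assms(2) frechet_derivative_at)
  then show ?thesis using assms(2) by (auto simp: differentiable_def)
qed

text \<open>Smoothness is local, which makes gluing of functions possible.\<close>

lemma Ck_on_local:
  assumes "\<And>x. x \<in> S \<Longrightarrow> \<exists>T. open T \<and> x \<in> T \<and> Ck_on k T f"
  shows "Ck_on k S f"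
  using assms
proof (induction k arbitrary: f)
  case 0
  have "isCont f x" if "x \<in> S" for x
    using 0[OF that] by (auto simp: continuous_on_eq_continuous_at)
  then show ?case by (simp add: continuous_at_imp_continuous_on)
next
  case (Suc k)
  have "Ck_on k S (\<lambda>x. frechet_derivative f (at x) v)" for v
  proof (rule Suc.IH)
    fix x assume "x \<in> S"
    from Suc.prems[OF this] show "\<exists>T. open T \<and> x \<in> T \<and> Ck_on k T (\<lambda>x. frechet_derivative f (at x) v)"
      by auto
  qed
  moreover have "f differentiable at x" if "x \<in> S" for x
    using Suc.prems[OF that] by auto
  ultimately show ?case by simp
qed

lemma Ck_on_const:
  assumes "open S"
  shows "Ck_on k S (\<lambda>x. c)"
proof (induction k arbitrary: c)
  case (Suc k)
  show ?case by (rule Ck_on_SucI[OF assms, where D = "\<lambda>_ _. 0"]) (simp_all add: Suc)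
qed simp

lemma Ck_on_ident:
  assumes "open S"
  shows "Ck_on k S (\<lambda>x. x)"
proof (cases k)
  case (Suc k)
  show ?thesis unfolding Suc
    by (rule Ck_on_SucI[OF assms, where D = "\<lambda>_ v. v"]) (auto intro: Ck_on_const assms)
qed simp

lemma Ck_on_bounded_linear:
  assumes "open S" "bounded_linear L" "Ck_on k S f"
  shows "Ck_on k S (\<lambda>x. L (f x))"
  using assms(3)
proof (induction k arbitrary: f)
  case 0
  then show ?case by (auto intro: bounded_linear.continuous_on assms)
next
  case (Suc k)
  show ?case
    by (rule Ck_on_SucI[OF assms(1), where D = "\<lambda>x v. L (frechet_derivative f (at x) v)"])
      (use Suc in \<open>auto intro!: bounded_linear.has_derivative[OF assms(2)] Ck_on_SucD[OF Suc.prems]\<close>)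
qed

lemma Ck_on_add:
  assumes "open S" "Ck_on k S f" "Ck_on k S h"
  shows "Ck_on k S (\<lambda>x. f x + h x)"
  using assms(2,3)
proof (induction k arbitrary: f h)
  case 0
  then show ?case by (auto intro: continuous_on_add)
next
  case (Suc k)
  show ?case
    by (rule Ck_on_SucI[OF assms(1),
        where D = "\<lambda>x v. frechet_derivative f (at x) v + frechet_derivative h (at x) v"])
      (use Suc in \<open>auto intro!: has_derivative_add Ck_on_SucD[OF Suc.prems(1)] Ck_on_SucD[OF Suc.prems(2)]\<close>)
qed

lemma Ck_on_sum:
  assumes "open S" "finite I" "\<And>i. i \<in> I \<Longrightarrow> Ck_on k S (f i)"
  shows "Ck_on k S (\<lambda>x. \<Sum>i\<in>I. f i x)"
  using assms(2,3) by (induction I rule: finite_induct) (auto intro: Ck_on_const Ck_on_add assms(1))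

lemma Ck_on_mult:
  fixes f h :: "'e::euclidean_space \<Rightarrow> real"
  assumes "open S" "Ck_on k S f" "Ck_on k S h"
  shows "Ck_on k S (\<lambda>x. f x * h x)"
  using assms(2,3)
proof (induction k arbitrary: f h)
  case 0
  then show ?case by (auto intro: continuous_on_mult)
next
  case (Suc k)
  have "Ck_on k S (\<lambda>x. f x * frechet_derivative h (at x) v + frechet_derivative f (at x) v * h x)" for v
    by (intro Ck_on_add Suc.IH assms(1) Ck_on_Suc_imp[OF Suc.prems(1)] Ck_on_Suc_imp[OF Suc.prems(2)])
      (use Suc.prems in auto)
  then show ?case
    using Ck_on_SucI[OF assms(1) has_derivative_mult[OF Ck_on_SucD[OF Suc.prems(1)] Ck_on_SucD[OF Suc.prems(2)]]]
    by blast
qed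

text \<open>The derivative of the outer function is expanded in a basis, so that the chain rule
  expresses directional derivatives of the composite as sums of products of \<open>C\<^sup>k\<close> functions,
  one of which is again a composite.\<close>

lemma Ck_on_compose:
  fixes f :: "'e::euclidean_space \<Rightarrow> 'f::euclidean_space" and h :: "'f \<Rightarrow> real"
  assumes "open S" "open T" "f ` S \<subseteq> T" "Ck_on k S f" "Ck_on k T h"
  shows "Ck_on k S (\<lambda>x. h (f x))"
  using assms(4,5)
proof (induction k arbitrary: h)
  case 0
  then show ?case using continuous_on_compose2[of T h S f] assms(3) by auto
next
  case (Suc k)
  let ?D = "\<lambda>x v. \<Sum>i\<in>Basis. (frechet_derivative f (at x) v \<bullet> i) * frechet_derivative h (at (f x)) i"
  show ?case
  proof (rule Ck_on_SucI[OF assms(1), where D = ?D])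
    fix x assume "x \<in> S"
    then have "(h has_derivative frechet_derivative h (at (f x))) (at (f x))"
      using assms(3) by (intro Ck_on_SucD[OF Suc.prems(2)]) auto
    note lin = has_derivative_linear[OF this] and
      c = has_derivative_compose[OF Ck_on_SucD[OF Suc.prems(1) \<open>x \<in> S\<close>] this]
    have "(\<Sum>i\<in>Basis. (w \<bullet> i) * frechet_derivative h (at (f x)) i)
        = frechet_derivative h (at (f x)) w" for w
      using linear_sum[OF lin, of "\<lambda>i. (w \<bullet> i) *\<^sub>R i" Basis]
      by (simp add: euclidean_representation linear_cmul[OF lin])
    then show "((\<lambda>x. h (f x)) has_derivative ?D x) (at x)" using c by simp
  next
    fix v
    have "Ck_on k S (\<lambda>x. frechet_derivative h (at (f x)) i)" for i
      by (rule Suc.IH) (use Suc.prems(2) Ck_on_Suc_imp[OF Suc.prems(1)] in auto)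
    moreover have "Ck_on k S (\<lambda>x. frechet_derivative f (at x) v \<bullet> i)" for i
      by (rule Ck_on_bounded_linear[OF assms(1) bounded_linear_inner_left]) (use Suc.prems in auto)
    ultimately show "Ck_on k S (\<lambda>x. ?D x v)"
      by (intro Ck_on_sum Ck_on_mult assms(1)) auto
  qed
qed

lemma smooth_on_add: "open S \<Longrightarrow> smooth_on S f \<Longrightarrow> smooth_on S h \<Longrightarrow> smooth_on S (\<lambda>x. f x + h x)"
  by (simp add: smooth_on_def Ck_on_add)

lemma smooth_on_mult:
  fixes f h :: "'e::euclidean_space \<Rightarrow> real"
  shows "open S \<Longrightarrow> smooth_on S f \<Longrightarrow> smooth_on S h \<Longrightarrow> smooth_on S (\<lambda>x. f x * h x)"
  by (simp add: smooth_on_def Ck_on_mult)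

lemma smooth_on_const: "open S \<Longrightarrow> smooth_on S (\<lambda>x. c)"
  by (simp add: smooth_on_def Ck_on_const)

lemma smooth_on_inner: "open S \<Longrightarrow> smooth_on S (\<lambda>x. x \<bullet> i)"
  unfolding smooth_on_def
  by (intro allI Ck_on_bounded_linear[OF _ bounded_linear_inner_left] Ck_on_ident)

lemma smooth_on_subset: "smooth_on T f \<Longrightarrow> S \<subseteq> T \<Longrightarrow> smooth_on S f"
  by (auto simp: smooth_on_def intro: Ck_on_subset)

lemma smooth_on_cong: "open S \<Longrightarrow> (\<And>x. x \<in> S \<Longrightarrow> f x = h x) \<Longrightarrow> smooth_on S f \<Longrightarrow> smooth_on S h"
  by (auto simp: smooth_on_def intro: Ck_on_cong)

lemma smooth_on_local:
  assumes "\<And>x. x \<in> S \<Longrightarrow> \<exists>T. open T \<and> x \<in> T \<and> smooth_on T f"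
  shows "smooth_on S f"
  unfolding smooth_on_def
proof
  fix k
  show "Ck_on k S f"
    by (rule Ck_on_local) (metis assms smooth_on_def)
qed

lemma smooth_on_compose:
  fixes f :: "'e::euclidean_space \<Rightarrow> 'f::euclidean_space" and h :: "'f \<Rightarrow> real"
  assumes "open S" "open T" "f ` S \<subseteq> T" "smooth_on S f" "smooth_on T h"
  shows "smooth_on S (\<lambda>x. h (f x))"
  using assms by (auto simp: smooth_on_def intro: Ck_on_compose)

lemma smooth_on_has_derivative:
  "smooth_on S f \<Longrightarrow> x \<in> S \<Longrightarrow> (f has_derivative frechet_derivative f (at x)) (at x)"
  unfolding smooth_on_def by (rule Ck_on_SucD[of 0]) auto

lemma smooth_on_frechet_derivative:
  "smooth_on S f \<Longrightarrow> smooth_on S (\<lambda>x. frechet_derivative f (at x) v)"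
  unfolding smooth_on_def by (metis Ck_on.simps(2))

section \<open>Bump functions\<close>

text \<open>For \<open>k = 0\<close> this is the classical smooth function that is flat at \<open>0\<close>. The powers of
  \<open>1/s\<close> are carried along so that the family is closed under differentiation.\<close>

definition flat :: "nat \<Rightarrow> real \<Rightarrow> real"
  where "flat k s = (if s > 0 then exp (- inverse s) * inverse s ^ k else 0)"

text \<open>The exponential dominates the term of order \<open>k + 2\<close> of its series. A quadratic bound is
  what differentiability at \<open>0\<close> with derivative \<open>0\<close> needs.\<close>

lemma flat_bound: "\<bar>flat k s\<bar> \<le> fact (k + 2) * s\<^sup>2"
proof (cases "s > 0")
  case True
  define y where "y = inverse s"
  have y: "y > 0" using True by (simp add: y_def)
  have "(\<Sum>i\<in>{k+2}. y ^ i /\<^sub>R fact i) \<le> (\<Sum>i. y ^ i /\<^sub>R fact i)"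
    using y by (intro sum_le_suminf summable_exp_generic) auto
  then have "y ^ (k + 2) / fact (k + 2) \<le> exp y"
    by (simp add: exp_def divide_inverse mult.commute del: fact_Suc)
  then have "y ^ k * y\<^sup>2 \<le> fact (k + 2) * exp y"
    by (simp only: power_add pos_divide_le_eq[OF fact_gt_zero] mult.commute[of "exp y"])
  then have "exp (- y) * y ^ k \<le> fact (k + 2) / y\<^sup>2"
    using y by (simp add: exp_minus field_simps del: fact_Suc)
  moreover have "fact (k + 2) / y\<^sup>2 = fact (k + 2) * s\<^sup>2" by (simp add: y_def field_simps)
  ultimately show ?thesis using True y by (simp add: flat_def y_def[symmetric])
qed (simp add: flat_def)

lemma has_derivative_flat:
  "(flat k has_real_derivative flat (k + 2) s - real k * flat (k + 1) s) (at s)"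
proof -
  consider "s > 0" | "s < 0" | "s = 0" by linarith
  then show ?thesis
  proof cases
    case 1
    have "((\<lambda>s. exp (- inverse s) * inverse s ^ k) has_real_derivative
        flat (k + 2) s - real k * flat (k + 1) s) (at s)"
      using 1 by (auto intro!: derivative_eq_intros simp: flat_def power2_eq_square)
        (cases k; simp add: field_simps)
    then show ?thesis
      by (rule has_field_derivative_transform_within_open[where S = "{0<..}"])
        (use 1 in \<open>auto simp: flat_def\<close>)
  next
    case 2
    have "((\<lambda>s. 0) has_real_derivative flat (k + 2) s - real k * flat (k + 1) s) (at s)"
      using 2 by (simp add: flat_def)
    then show ?thesis
      by (rule has_field_derivative_transform_within_open[where S = "{..<0}"])
        (use 2 in \<open>auto simp: flat_def\<close>)
  next
    case 3
    have "((\<lambda>y. (flat k y - flat k 0) / (y - 0)) \<longlongrightarrow> 0) (at 0)"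
    proof (rule Lim_null_comparison)
      show "\<forall>\<^sub>F y in at 0. norm ((flat k y - flat k 0) / (y - 0)) \<le> fact (k + 2) * \<bar>y\<bar>"
      proof (rule eventually_at_ball'[OF zero_less_one, THEN eventually_mono])
        fix y :: real assume "y \<in> ball 0 1 \<and> y \<noteq> 0 \<and> y \<in> UNIV"
        then have "\<bar>flat k y\<bar> \<le> (fact (k + 2) * \<bar>y\<bar>) * \<bar>y\<bar>" "0 < \<bar>y\<bar>"
          using flat_bound[of k y] by (simp_all add: power2_eq_square mult.assoc del: fact_Suc)
        then show "norm ((flat k y - flat k 0) / (y - 0)) \<le> fact (k + 2) * \<bar>y\<bar>"
          by (simp add: flat_def[of k 0] pos_divide_le_eq del: fact_Suc)
      qed
      show "((\<lambda>y. fact (k + 2) * \<bar>y\<bar>) \<longlongrightarrow> 0) (at (0::real))"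
        by (auto intro!: tendsto_eq_intros)
    qed
    then show ?thesis using 3 by (simp add: has_field_derivative_iff flat_def)
  qed
qed

lemma smooth_on_flat: "smooth_on UNIV (flat m)"
proof -
  have "Ck_on k UNIV (flat m)" for k
  proof (induction k arbitrary: m)
    case 0
    then show ?case
      by (auto intro!: continuous_at_imp_continuous_on DERIV_isCont[OF has_derivative_flat])
  next
    case (Suc k)
    have "Ck_on k UNIV (\<lambda>s. (flat (m + 2) s + (- real m) * flat (m + 1) s) * v)" for v
      by (intro Ck_on_mult Ck_on_add Ck_on_const Suc) auto
    then show ?case
      by (intro Ck_on_SucI[where D = "\<lambda>s v. (flat (m + 2) s + (- real m) * flat (m + 1) s) * v"])
        (use has_derivative_flat[of m] in \<open>auto simp: has_field_derivative_def\<close>)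
  qed
  then show ?thesis by (simp add: smooth_on_def)
qed

text \<open>\<open>exp (- 1 / (r\<^sup>2 - |x - a|\<^sup>2))\<close>, extended by zero.\<close>

lemma smooth_bump_exists:
  fixes a :: "'e::euclidean_space"
  assumes "r > 0"
  obtains B :: "'e \<Rightarrow> real" where "smooth_on UNIV B" "B a \<noteq> 0" "\<And>x. x \<notin> cball a r \<Longrightarrow> B x = 0"
proof
  let ?q = "\<lambda>x. r\<^sup>2 + (\<Sum>i\<in>Basis. - 1 * ((x \<bullet> i + - (a \<bullet> i)) * (x \<bullet> i + - (a \<bullet> i))))"
  have q: "?q x = r\<^sup>2 - (dist a x)\<^sup>2" for x
  proof -
    have "(dist a x)\<^sup>2 = (\<Sum>i\<in>Basis. (a \<bullet> i - x \<bullet> i)\<^sup>2)"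
      by (simp add: euclidean_dist_l2[of a x] L2_set_def dist_real_def sum_nonneg)
    also have "\<dots> = - (\<Sum>i\<in>Basis. - 1 * ((x \<bullet> i + - (a \<bullet> i)) * (x \<bullet> i + - (a \<bullet> i))))"
      unfolding sum_negf[symmetric] by (intro sum.cong) (auto simp: power2_eq_square algebra_simps)
    finally show ?thesis by simp
  qed
  have "smooth_on UNIV ?q"
    unfolding smooth_on_def
    by (intro allI Ck_on_add Ck_on_sum Ck_on_mult Ck_on_const
        Ck_on_bounded_linear[OF _ bounded_linear_inner_left] Ck_on_ident) auto
  then show "smooth_on UNIV (\<lambda>x. flat 0 (?q x))"
    by (intro smooth_on_compose[OF _ _ _ _ smooth_on_flat]) auto
  show "flat 0 (?q a) \<noteq> 0" using assms unfolding q by (simp add: flat_def)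
  show "flat 0 (?q x) = 0" if "x \<notin> cball a r" for x
  proof -
    have "r\<^sup>2 \<le> (dist a x)\<^sup>2" using that assms by (intro power_mono) auto
    then show ?thesis unfolding q by (simp add: flat_def)
  qed
qed

section \<open>Linear algebra\<close>

lemma linear_onD:
  assumes "linear_on V f"
  shows linear_on_add: "x \<in> V \<Longrightarrow> y \<in> V \<Longrightarrow> f (x + y) = f x + f y"
    and linear_on_scaleR: "x \<in> V \<Longrightarrow> f (a *\<^sub>R x) = a *\<^sub>R f x"
  using assms by (auto simp: linear_on_def)

lemma linear_on_sum:
  assumes "subspace V" "linear_on V f" "finite I" "\<And>i. i \<in> I \<Longrightarrow> v i \<in> V"
  shows "f (\<Sum>i\<in>I. a i *\<^sub>R v i) = (\<Sum>i\<in>I. a i *\<^sub>R f (v i))"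
  using assms(3,4)
proof (induction I rule: finite_induct)
  case empty
  have "f (0 *\<^sub>R 0) = 0 *\<^sub>R f 0" by (rule linear_on_scaleR[OF assms(2) subspace_0[OF assms(1)]])
  then show ?case by simp
next
  case (insert i I)
  then show ?case
    using assms(1,2) by (simp add: linear_on_add linear_on_scaleR subspace_sum subspace_scale)
qed

text \<open>Functionals that are dual to the family \<open>e\<close> up to the factor \<open>b\<close> make \<open>e\<close> independent; as
  the size of \<open>e\<close> is the dimension, \<open>e\<close> spans, and the functionals read off coordinates.\<close>

lemma dual_family_expansion:
  fixes e :: "'i \<Rightarrow> 'v::real_vector" and w :: "'i \<Rightarrow> 'v \<Rightarrow> real"
  assumes "finite I" "finite S" "independent S" "card S = card I" "e ` I \<subseteq> span S"
    and lin: "\<And>j. j \<in> I \<Longrightarrow> linear (w j)"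
    and dual: "\<And>i j. i \<in> I \<Longrightarrow> j \<in> I \<Longrightarrow> w j (e i) = (if i = j then b else 0)"
    and "b \<noteq> 0" "v \<in> span S"
  shows "b *\<^sub>R v = (\<Sum>j\<in>I. w j v *\<^sub>R e j)"
proof -
  have wsum: "w j (\<Sum>i\<in>I. a i *\<^sub>R e i) = a j * b" if "j \<in> I" for a j
  proof -
    have "w j (\<Sum>i\<in>I. a i *\<^sub>R e i) = (\<Sum>i\<in>I. a i * (if i = j then b else 0))"
      using lin[OF that] that dual by (simp add: linear_sum linear_cmul)
    also have "\<dots> = (\<Sum>i\<in>I. if i = j then a j * b else 0)" by (intro sum.cong) auto
    finally show ?thesis using assms(1) that by simp
  qed
  have inj: "inj_on e I"
    by (rule inj_onI) (metis dual assms(8))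
  have "independent (e ` I)"
  proof (rule independent_if_scalars_zero)
    fix f x assume s: "(\<Sum>x\<in>e ` I. f x *\<^sub>R x) = 0" and "x \<in> e ` I"
    then obtain j where j: "j \<in> I" "x = e j" by blast
    have "(\<Sum>i\<in>I. f (e i) *\<^sub>R e i) = 0" using s inj by (simp add: sum.reindex)
    then show "f x = 0" using wsum[OF j(1), of "\<lambda>i. f (e i)"] lin[OF j(1)] assms(8) j(2)
      by (simp add: linear_0)
  qed (use assms(1) in auto)
  have "v \<in> span (e ` I)"
  proof (rule ccontr)
    assume nv: "v \<notin> span (e ` I)"
    then have "independent (insert v (e ` I))"
      using \<open>independent (e ` I)\<close> by (simp add: independent_insertI)
    moreover have "insert v (e ` I) \<subseteq> span S" using assms(5,9) by simp
    ultimately have "card (insert v (e ` I)) \<le> card S"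
      using independent_span_bound[OF assms(2)] by simp
    moreover have "v \<notin> e ` I" using nv span_base by metis
    moreover have "card (e ` I) = card S" using inj assms(4) by (simp add: card_image)
    ultimately show False using assms(1) by simp
  qed
  then obtain f where "v = (\<Sum>x\<in>e ` I. f x *\<^sub>R x)"
    using assms(1) by (auto simp: span_finite)
  then have v: "v = (\<Sum>i\<in>I. f (e i) *\<^sub>R e i)" using inj by (simp add: sum.reindex)
  show ?thesis
    unfolding v by (simp add: wsum scaleR_sum_right mult.commute)
qed

text \<open>The usual computation \<open>tr (P Q) = tr (Q P)\<close> for the two change of basis matrices.\<close>

lemma trace_basis_independent:
  fixes f :: "'v::real_vector \<Rightarrow> 'v"
  assumes "finite B" "finite C" "independent B" "independent C" "span B = span C"
    and "linear_on (span B) f" "f ` span B \<subseteq> span B"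
  shows "(\<Sum>b\<in>B. representation B (f b) b) = (\<Sum>c\<in>C. representation C (f c) c)"
proof -
  have lin: "linear_on (span B) (\<lambda>x. representation C (f x) c)" for c
    unfolding linear_on_def
  proof (intro conjI allI ballI)
    fix x y assume "x \<in> span B" "y \<in> span B"
    then show "representation C (f (x + y)) c = representation C (f x) c + representation C (f y) c"
      using assms by (simp add: linear_on_add[OF assms(6)] representation_add image_subset_iff)
  next
    fix a x assume "x \<in> span B"
    then show "representation C (f (a *\<^sub>R x)) c = a *\<^sub>R representation C (f x) c"
      using assms by (simp add: linear_on_scaleR[OF assms(6)] representation_scale image_subset_iff)
  qed
  have "representation B (f b) b = (\<Sum>c\<in>C. representation C (f b) c * representation B c b)"
    if "b \<in> B" for b
  proof -
    have fb: "f b \<in> span C" using assms(5,7) that span_base[OF that] by blast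
    have "f b = (\<Sum>c\<in>C. representation C (f b) c *\<^sub>R c)"
      using sum_representation_eq[OF assms(4) fb assms(2)] by simp
    then have "representation B (f b) = representation B (\<Sum>c\<in>C. representation C (f b) c *\<^sub>R c)"
      by simp
    also have "\<dots> = (\<lambda>x. \<Sum>c\<in>C. representation C (f b) c * representation B c x)"
      using assms(3,5) span_base[of _ C]
      by (subst representation_sum) (auto simp: representation_scale span_scale)
    finally show ?thesis by metis
  qed
  then have "(\<Sum>b\<in>B. representation B (f b) b)
      = (\<Sum>c\<in>C. \<Sum>b\<in>B. representation B c b * representation C (f b) c)"
    by (simp add: sum.swap[of _ B] mult.commute)
  also have "\<dots> = (\<Sum>c\<in>C. representation C (f c) c)"
  proof (rule sum.cong[OF refl])
    fix c assume c: "c \<in> C"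
    then have cB: "c \<in> span B" using assms(5) span_base by blast
    have "representation C (f c) c = representation C (f (\<Sum>b\<in>B. representation B c b *\<^sub>R b)) c"
      using sum_representation_eq[OF assms(3) cB assms(1)] by simp
    also have "\<dots> = (\<Sum>b\<in>B. representation B c b *\<^sub>R representation C (f b) c)"
      by (rule linear_on_sum[OF subspace_span lin assms(1)]) (simp add: span_base)
    finally show "(\<Sum>b\<in>B. representation B c b * representation C (f b) c) = representation C (f c) c"
      by simp
  qed
  finally show ?thesis .
qed

text \<open>A complex basis \<open>C\<close> of the space gives the real basis \<open>C \<union> J C\<close>. It is found as a maximal
  set for which \<open>C \<union> J C\<close> is independent: the span of \<open>C \<union> J C\<close> is invariant under \<open>J\<close>, and a vector
  \<open>x\<close> outside of it could be added to \<open>C\<close>, because \<open>J\<close> has no real eigenvalue on the quotient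
  by this span.\<close>

lemma complex_structure_adapted_basis:
  fixes J :: "'v::real_vector \<Rightarrow> 'v"
  assumes "finite B" "span B = W" "linear_on W J" "J ` W \<subseteq> W"
    and JJ: "\<And>x. x \<in> W \<Longrightarrow> J (J x) = - x"
  obtains C where "finite C" "C \<inter> J ` C = {}" "independent (C \<union> J ` C)" "span (C \<union> J ` C) = W"
proof -
  define good where
    "good C \<longleftrightarrow> finite C \<and> C \<subseteq> W \<and> C \<inter> J ` C = {} \<and> independent (C \<union> J ` C)" for C
  have W: "subspace W" using assms(2) by auto
  have "card C \<le> card B" if "good C" for C
  proof -
    have "C \<subseteq> span B" "independent C"
      using that assms(2) independent_mono by (auto simp: good_def)
    then show ?thesis using independent_span_bound[OF assms(1)] by simp
  qed
  then have "\<forall>C. good C \<longrightarrow> card C < Suc (card B)" by (simp add: less_Suc_eq_le)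
  moreover have "good {}" by (simp add: good_def independent_empty)
  ultimately obtain C where gC: "good C" and max: "\<And>C'. good C' \<Longrightarrow> card C' \<le> card C"
    using ex_has_greatest_nat[of good "{}" card "Suc (card B)"] by blast
  then have C: "finite C" "C \<subseteq> W" "C \<inter> J ` C = {}" "independent (C \<union> J ` C)"
    by (simp_all add: good_def)
  let ?S = "span (C \<union> J ` C)"
  have sub: "C \<union> J ` C \<subseteq> W" using C assms(4) by blast
  have SW: "?S \<subseteq> W" by (rule span_minimal[OF sub W])
  have "x \<in> W \<and> J x \<in> ?S" if "x \<in> ?S" for x
    using that
  proof (induction rule: span_induct_alt)
    case base
    have "J (0 *\<^sub>R 0) = 0 *\<^sub>R J 0" using linear_on_scaleR[OF assms(3)] subspace_0[OF W] by blast
    then show ?case by (simp add: span_zero subspace_0[OF W])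
  next
    case (step c x y)
    have xW: "x \<in> W" using step(1) sub by blast
    have "J x \<in> ?S"
    proof (cases "x \<in> C")
      case False
      then obtain d where "d \<in> C" "x = J d" using step(1) by blast
      then have "J x = - d" using JJ C by blast
      then show ?thesis using \<open>d \<in> C\<close> by (simp add: span_neg span_base)
    qed (simp add: span_base)
    moreover have "J (c *\<^sub>R x + y) = c *\<^sub>R J x + J y"
      using xW step(2) W
      by (simp add: linear_on_add[OF assms(3)] linear_on_scaleR[OF assms(3)] subspace_scale)
    ultimately show ?case using step(2) xW W
      by (simp add: span_add span_scale subspace_add subspace_scale)
  qed
  then have JS: "J x \<in> ?S" if "x \<in> ?S" for x using that by simp
  have "?S = W"
  proof (rule ccontr)
    assume "?S \<noteq> W"
    then obtain x where x: "x \<in> W" "x \<notin> ?S" using SW by blast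
    have Jx: "J x \<in> W" using x assms(4) by blast
    \<comment> \<open>If \<open>J x = a x + s\<close> with \<open>s\<close> in the span, then applying \<open>J\<close> gives \<open>- x = a\<^sup>2 x\<close> modulo
      the span.\<close>
    have nJx: "J x \<notin> span (insert x (C \<union> J ` C))"
    proof
      assume "J x \<in> span (insert x (C \<union> J ` C))"
      then obtain a where a: "J x - a *\<^sub>R x \<in> ?S" using span_breakdown_eq by blast
      define s where "s = J x - a *\<^sub>R x"
      have sW: "s \<in> W" using a SW s_def by blast
      have "- x = J (s + a *\<^sub>R x)" using JJ[OF x(1)] by (simp add: s_def)
      also have "\<dots> = J s + a *\<^sub>R J x"
        using sW x(1) W by (simp add: linear_on_add[OF assms(3)] linear_on_scaleR[OF assms(3)] subspace_scale)
      also have "\<dots> = J s + a *\<^sub>R (s + a *\<^sub>R x)" by (simp add: s_def)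
      finally have "- x = J s + a *\<^sub>R s + (a * a) *\<^sub>R x" by (simp add: scaleR_add_right)
      then have "J s + a *\<^sub>R s = - x - (a * a) *\<^sub>R x" by (simp add: algebra_simps)
      also have "\<dots> = - (1 + a * a) *\<^sub>R x" by (simp add: algebra_simps)
      finally have "J s + a *\<^sub>R s = - (1 + a * a) *\<^sub>R x" .
      moreover have "J s + a *\<^sub>R s \<in> ?S" using JS a by (simp add: s_def[symmetric] span_add span_scale)
      ultimately have "- (1 + a * a) *\<^sub>R x \<in> ?S" by simp
      then have "inverse (- (1 + a * a)) *\<^sub>R (- (1 + a * a)) *\<^sub>R x \<in> ?S" by (rule span_scale)
      moreover have "1 + a * a > 0" by (simp add: add_pos_nonneg)
      ultimately show False using x(2) by simp
    qed
    then have ind: "independent (insert (J x) (insert x (C \<union> J ` C)))"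
      using C x(2) by (simp add: independent_insertI)
    moreover have "insert x C \<union> J ` insert x C = insert (J x) (insert x (C \<union> J ` C))" by blast
    moreover have "insert x C \<inter> J ` insert x C = {}"
    proof -
      have "x \<notin> J ` C" "x \<notin> C" using x(2) span_base[of x "C \<union> J ` C"] by auto
      moreover have "J x \<notin> insert x C"
        using nJx span_base[of "J x" "insert x (C \<union> J ` C)"] by auto
      ultimately show ?thesis using C(3) by (simp add: Int_insert_left Int_insert_right)
    qed
    ultimately have "good (insert x C)" using C x(1) by (simp add: good_def)
    from max[OF this] show False using C x(2) span_base[of x "C \<union> J ` C"] by (cases "x \<in> C") auto
  qed
  with C show ?thesis by (intro that) auto
qed

text \<open>In an adapted basis the matrix of \<open>J\<close> has zero diagonal.\<close>

lemma complex_structure_trace_zero: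
  fixes J :: "'v::real_vector \<Rightarrow> 'v"
  assumes "finite B" "independent B" "linear_on (span B) J" "J ` span B \<subseteq> span B"
    and JJ: "\<And>x. x \<in> span B \<Longrightarrow> J (J x) = - x"
  shows "(\<Sum>b\<in>B. representation B (J b) b) = 0"
proof -
  obtain C where C: "finite C" "C \<inter> J ` C = {}" "independent (C \<union> J ` C)"
    "span (C \<union> J ` C) = span B"
    using complex_structure_adapted_basis[OF assms(1) refl assms(3,4) JJ] by blast
  let ?C = "C \<union> J ` C"
  have "representation ?C (J c) c = 0" if "c \<in> ?C" for c
  proof (cases "c \<in> C")
    case True
    then show ?thesis using C by (subst representation_basis) auto
  next
    case False
    with that obtain d where d: "d \<in> C" "c = J d" by blast
    then have "J c = - d" using JJ[of d] C(4) span_base[of d ?C] by auto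
    then have "representation ?C (J c) c = - representation ?C d c"
      using C(3) d by (simp add: representation_neg span_base)
    then show ?thesis using C d False by (subst (asm) representation_basis) auto
  qed
  then show ?thesis
    using trace_basis_independent[OF assms(1) _ assms(2) C(3) C(4)[symmetric] assms(3,4)] C(1) by simp
qed

section \<open>The structure on a tangent space\<close>

locale almost_contact_B_metric_space =
  fixes V :: "'v::real_vector set" and n :: nat and \<phi> :: "'v \<Rightarrow> 'v" and \<xi> :: 'v
    and \<eta> :: "'v \<Rightarrow> real" and g :: "'v \<Rightarrow> 'v \<Rightarrow> real"
  assumes n_pos: "n \<ge> 1"
    and V: "subspace V"
    and phi_lin: "linear_on V \<phi>"
    and phi_V [simp]: "x \<in> V \<Longrightarrow> \<phi> x \<in> V"
    and xi_V [simp]: "\<xi> \<in> V"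
    and eta_lin: "linear_on V \<eta>"
    and g_bil: "symmetric_bilinear_on V g"
    and g_sig: "has_signature V g (n + 1) n"
    and phi_xi [simp]: "\<phi> \<xi> = 0"
    and phi_phi: "x \<in> V \<Longrightarrow> \<phi> (\<phi> x) = - x + \<eta> x *\<^sub>R \<xi>"
    and eta_phi [simp]: "x \<in> V \<Longrightarrow> \<eta> (\<phi> x) = 0"
    and eta_xi [simp]: "\<eta> \<xi> = 1"
    and g_phi_phi: "x \<in> V \<Longrightarrow> y \<in> V \<Longrightarrow> g (\<phi> x) (\<phi> y) = - g x y + \<eta> x * \<eta> y"
begin

lemma V_closed [simp]:
  "0 \<in> V" "x \<in> V \<Longrightarrow> y \<in> V \<Longrightarrow> x + y \<in> V" "x \<in> V \<Longrightarrow> a *\<^sub>R x \<in> V"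
  "x \<in> V \<Longrightarrow> - x \<in> V" "x \<in> V \<Longrightarrow> y \<in> V \<Longrightarrow> x - y \<in> V"
  using V by (auto simp: subspace_0 subspace_add subspace_scale subspace_neg subspace_diff)

lemma g_commute: "x \<in> V \<Longrightarrow> y \<in> V \<Longrightarrow> g x y = g y x"
  and g_lin_right: "x \<in> V \<Longrightarrow> linear_on V (g x)"
  using g_bil by (auto simp: symmetric_bilinear_on_def)

lemma g_lin_left: "y \<in> V \<Longrightarrow> linear_on V (\<lambda>x. g x y)"
  using g_lin_right[of y] g_commute unfolding linear_on_def by simp

lemmas g_add_right = linear_on_add[OF g_lin_right]
  and g_scaleR_right = linear_on_scaleR[OF g_lin_right]
  and g_add_left = linear_on_add[OF g_lin_left]
  and g_scaleR_left = linear_on_scaleR[OF g_lin_left]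
  and phi_add = linear_on_add[OF phi_lin]
  and phi_scaleR = linear_on_scaleR[OF phi_lin]
  and eta_add = linear_on_add[OF eta_lin]
  and eta_scaleR = linear_on_scaleR[OF eta_lin]

lemma zero_simps [simp]:
  "x \<in> V \<Longrightarrow> g x 0 = 0" "x \<in> V \<Longrightarrow> g 0 x = 0" "\<phi> 0 = 0" "\<eta> 0 = 0"
  using g_scaleR_right[of x 0 0] g_scaleR_left[of x 0 0] phi_scaleR[of 0 0] eta_scaleR[of 0 0]
  by auto

lemma g_xi: "x \<in> V \<Longrightarrow> g x \<xi> = \<eta> x"
  using g_phi_phi[of x \<xi>] by simp

lemma g_xi': "x \<in> V \<Longrightarrow> g \<xi> x = \<eta> x"
  using g_xi[of x] g_commute[of x \<xi>] by simp

lemma phi_phi_phi: "x \<in> V \<Longrightarrow> \<phi> (\<phi> (\<phi> x)) = - \<phi> x"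
  by (simp add: phi_phi[of "\<phi> x"])

lemma phi_minus: "x \<in> V \<Longrightarrow> \<phi> (- x) = - \<phi> x"
  using phi_scaleR[of x "-1"] by simp

lemma g_minus_right: "x \<in> V \<Longrightarrow> y \<in> V \<Longrightarrow> g x (- y) = - g x y"
  using g_scaleR_right[of x y "-1"] by simp

lemma g_minus_left: "x \<in> V \<Longrightarrow> y \<in> V \<Longrightarrow> g (- x) y = - g x y"
  using g_scaleR_left[of y x "-1"] by simp

text \<open>The metric is anti-invariant and \<open>\<phi>\<close> squares to \<open>-1\<close> on \<open>H\<close>; the two signs cancel.\<close>

lemma g_phi:
  assumes "x \<in> V" "y \<in> V"
  shows "g (\<phi> x) y = g x (\<phi> y)"
proof -
  have "g (\<phi> x) (\<phi> (\<phi> y)) = - g x (\<phi> y)" using assms by (simp add: g_phi_phi)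
  moreover have "g (\<phi> x) (\<phi> (\<phi> y)) = - g (\<phi> x) y"
    using assms by (simp only: phi_phi[of y] g_add_right V_closed phi_V xi_V g_minus_right
      g_scaleR_right g_xi eta_phi) simp
  ultimately show ?thesis by simp
qed

text \<open>In an orthonormal basis of an indefinite metric the coefficient at \<open>x\<close> of the
  representing vector is \<open>g(x, x) f(x)\<close>, where \<open>g(x, x)\<close> is a sign.\<close>

lemma riesz:
  assumes "linear_on V f"
  obtains e where "e \<in> V" "\<And>y. y \<in> V \<Longrightarrow> g e y = f y"
proof -
  from g_sig obtain P N where PN: "finite P" "finite N" "P \<inter> N = {}" "span (P \<union> N) = V"
    "\<forall>x\<in>P. g x x = 1" "\<forall>x\<in>N. g x x = -1" "\<forall>x\<in>P \<union> N. \<forall>y\<in>P \<union> N. x \<noteq> y \<longrightarrow> g x y = 0"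
    unfolding has_signature_def by metis
  have PNV: "P \<union> N \<subseteq> V" using PN(4) span_superset by blast
  define e where "e = (\<Sum>x\<in>P \<union> N. (f x * g x x) *\<^sub>R x)"
  have eV: "e \<in> V" unfolding e_def using PNV by (intro subspace_sum V) auto
  have base: "g e y = f y" if y: "y \<in> P \<union> N" for y
  proof -
    have "g e y = (\<Sum>x\<in>P \<union> N. (f x * g x x) *\<^sub>R g x y)"
      unfolding e_def using y PNV PN(1,2)
      by (intro linear_on_sum[OF V g_lin_left]) auto
    also have "\<dots> = (\<Sum>x\<in>P \<union> N. if x = y then f y * g y y * g y y else 0)"
      using PN(7) y by (intro sum.cong) auto
    also have "\<dots> = f y * (g y y * g y y)" using y PN(1,2) by simp
    also have "g y y * g y y = 1" using y PN(5,6) by auto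
    finally show ?thesis by simp
  qed
  have "g e y = f y \<and> y \<in> V" if "y \<in> span (P \<union> N)" for y
    using that
  proof (induction rule: span_induct_alt)
    case base
    then show ?case using eV linear_on_scaleR[OF assms, of 0 0] by simp
  next
    case (step c x y)
    have "x \<in> V" using PNV step(1) by blast
    then show ?case using step(2) base[OF step(1)] eV
      by (simp add: g_add_right g_scaleR_right linear_on_add[OF assms] linear_on_scaleR[OF assms])
  qed
  then show ?thesis using that[OF eV] PN(4) by simp
qed

abbreviation H :: "'v set" where "H \<equiv> {x \<in> V. \<eta> x = 0}"

lemma subspace_H: "subspace H"
  by (auto simp: subspace_def eta_add eta_scaleR)

text \<open>The basis and the inverse Gram matrix that the Lee form picks. They are arbitrary, so
  everything below has to be derived from their defining properties.\<close>

definition hbasis :: "'v set" where "hbasis = (SOME C. independent C \<and> span C = H)"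
definition ginv :: "'v \<Rightarrow> 'v \<Rightarrow> real" where "ginv = (SOME h. inverse_gram g hbasis h)"

lemma hbasis: "independent hbasis" "span hbasis = H"
proof -
  obtain C where "C \<subseteq> H" "independent C" "H \<subseteq> span C" by (rule basis_exists)
  then have "independent C \<and> span C = H" using span_minimal[OF _ subspace_H, of C] by simp
  then have "independent hbasis \<and> span hbasis = H" unfolding hbasis_def by (rule someI)
  then show "independent hbasis" "span hbasis = H" by auto
qed

lemma hbasis_H: "hbasis \<subseteq> H" using hbasis(2) span_superset[of hbasis] by simp

lemma hbasis_V [simp]: "x \<in> hbasis \<Longrightarrow> x \<in> V" and hbasis_eta [simp]: "x \<in> hbasis \<Longrightarrow> \<eta> x = 0"
  using hbasis_H by auto

lemma xi_hbasis: "\<xi> \<notin> span hbasis" using hbasis(2) by simp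

lemma full_basis: "independent (insert \<xi> hbasis)" "span (insert \<xi> hbasis) = V"
proof -
  show "independent (insert \<xi> hbasis)" using hbasis(1) xi_hbasis by (rule independent_insertI[rotated])
  show "span (insert \<xi> hbasis) = V"
  proof
    show "span (insert \<xi> hbasis) \<subseteq> V" using hbasis_H by (intro span_minimal V) auto
    show "V \<subseteq> span (insert \<xi> hbasis)"
    proof
      fix x assume "x \<in> V"
      then have "x - \<eta> x *\<^sub>R \<xi> \<in> span hbasis" using eta_add[of x "- \<eta> x *\<^sub>R \<xi>"]
        by (simp add: hbasis(2) eta_scaleR[of \<xi> "- \<eta> x", simplified])
      then show "x \<in> span (insert \<xi> hbasis)" using span_breakdown_eq by blast
    qed
  qed
qed

lemma finite_hbasis: "finite hbasis" and card_hbasis: "card hbasis = 2 * n"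
proof -
  from g_sig obtain P N where PN: "finite P" "finite N" "card P = n + 1" "card N = n" "P \<inter> N = {}"
    "independent (P \<union> N)" "span (P \<union> N) = V"
    unfolding has_signature_def by metis
  have "insert \<xi> hbasis \<subseteq> span (P \<union> N)" using hbasis_H unfolding PN(7) by auto
  then have "finite (insert \<xi> hbasis)"
    using independent_span_bound[OF _ full_basis(1)] PN(1,2) by auto
  then show f: "finite hbasis" by simp
  have "card (insert \<xi> hbasis) = card (P \<union> N)"
    using dim_span_eq_card_independent[OF full_basis(1)] dim_span_eq_card_independent[OF PN(6)]
    by (simp add: full_basis(2) PN(7))
  moreover have "\<xi> \<notin> hbasis" using xi_hbasis span_base[of \<xi> hbasis] by auto
  ultimately show "card hbasis = 2 * n" using f PN by (simp add: card_Un_disjoint)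
qed

lemma coordinate_linear: "linear_on V (\<lambda>x. representation (insert \<xi> hbasis) x u)"
  unfolding linear_on_def using full_basis by (simp add: representation_add representation_scale)

text \<open>An inverse Gram matrix exists: its row at \<open>u\<close> consists of the coordinates of the vector
  that represents the coordinate functional at \<open>u\<close>. This vector is horizontal because the
  coordinate functional vanishes at \<open>\<xi>\<close>.\<close>

lemma inverse_gram_ginv: "inverse_gram g hbasis ginv"
proof -
  have "\<exists>c. \<forall>w\<in>hbasis. (\<Sum>t\<in>hbasis. c t * g t w) = (if u = w then 1 else 0)" if u: "u \<in> hbasis" for u
  proof -
    obtain e where e: "e \<in> V" "\<And>y. y \<in> V \<Longrightarrow> g e y = representation (insert \<xi> hbasis) y u"
      using riesz[OF coordinate_linear] by blast
    have rb: "representation (insert \<xi> hbasis) w u = (if w = u then 1 else 0)" if "w \<in> insert \<xi> hbasis" for w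
      using representation_basis[OF full_basis(1) that] by simp
    have "\<xi> \<noteq> u" using u xi_hbasis span_base[of u hbasis] by auto
    then have "\<eta> e = 0" using e(2)[of \<xi>] rb[of \<xi>] g_xi[OF e(1)] by simp
    then have "e \<in> span hbasis" using e(1) hbasis(2) by simp
    then obtain c where c: "e = (\<Sum>t\<in>hbasis. c t *\<^sub>R t)" using span_finite[OF finite_hbasis] by auto
    have "(\<Sum>t\<in>hbasis. c t * g t w) = (if u = w then 1 else 0)" if w: "w \<in> hbasis" for w
    proof -
      have "(\<Sum>t\<in>hbasis. c t *\<^sub>R g t w) = g e w"
        unfolding c using w by (intro linear_on_sum[OF V g_lin_left finite_hbasis, symmetric]) auto
      then show ?thesis using e(2)[of w] rb[of w] w by auto
    qed
    then show ?thesis by blast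
  qed
  then obtain h where "\<forall>u\<in>hbasis. \<forall>w\<in>hbasis. (\<Sum>t\<in>hbasis. h u t * g t w) = (if u = w then 1 else 0)" by metis
  then have "inverse_gram g hbasis h" by (simp add: inverse_gram_def)
  then show ?thesis unfolding ginv_def by (rule someI[of "inverse_gram g hbasis"])
qed

lemma nondegenerate:
  assumes "x \<in> V" "\<And>z. z \<in> V \<Longrightarrow> g x z = 0"
  shows "x = 0"
proof -
  have "representation (insert \<xi> hbasis) x u = 0" for u
  proof -
    obtain e where e: "e \<in> V" "\<And>y. y \<in> V \<Longrightarrow> g e y = representation (insert \<xi> hbasis) y u"
      using riesz[OF coordinate_linear] by blast
    then show ?thesis using assms g_commute[of e x] by simp
  qed
  moreover have "(\<Sum>b\<in>insert \<xi> hbasis. representation (insert \<xi> hbasis) x b *\<^sub>R b) = x"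
    using assms(1) full_basis finite_hbasis by (intro sum_representation_eq) auto
  ultimately show ?thesis by simp
qed

lemma expand_H:
  assumes "x \<in> H"
  obtains c where "x = (\<Sum>t\<in>hbasis. c t *\<^sub>R t)"
  using assms hbasis(2) span_finite[OF finite_hbasis] by auto

lemma ginv_coordinate:
  assumes "u \<in> hbasis" "x = (\<Sum>t\<in>hbasis. c t *\<^sub>R t)"
  shows "(\<Sum>w\<in>hbasis. ginv u w * g w x) = c u"
proof -
  have "(\<Sum>w\<in>hbasis. ginv u w * g w x) = (\<Sum>w\<in>hbasis. \<Sum>t\<in>hbasis. c t * (ginv u w * g w t))"
    unfolding assms(2)
    by (intro sum.cong refl)
      (simp add: linear_on_sum[OF V g_lin_right finite_hbasis] sum_distrib_left mult.left_commute)
  also have "\<dots> = (\<Sum>t\<in>hbasis. c t * (\<Sum>w\<in>hbasis. ginv u w * g w t))"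
    by (subst sum.swap) (simp add: sum_distrib_left)
  also have "\<dots> = (\<Sum>t\<in>hbasis. if u = t then c t else 0)"
    using inverse_gram_ginv assms(1) by (intro sum.cong) (auto simp: inverse_gram_def)
  finally show ?thesis using assms(1) finite_hbasis by simp
qed

text \<open>Contraction with the inverse Gram matrix undoes a pairing with \<open>g\<close>; both orders of the
  indices occur in the trace of a tensor of type \<open>\<F>\<^sub>1\<close>.\<close>

lemma ginv_contract:
  assumes "linear_on V f" "x \<in> H"
  shows "(\<Sum>u\<in>hbasis. \<Sum>w\<in>hbasis. ginv u w * (g w x * f u)) = f x"
proof -
  obtain c where c: "x = (\<Sum>t\<in>hbasis. c t *\<^sub>R t)" using expand_H[OF assms(2)] .
  have "(\<Sum>u\<in>hbasis. \<Sum>w\<in>hbasis. ginv u w * (g w x * f u)) = (\<Sum>u\<in>hbasis. (\<Sum>w\<in>hbasis. ginv u w * g w x) * f u)"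
    by (simp add: sum_distrib_right mult.assoc)
  also have "\<dots> = (\<Sum>u\<in>hbasis. c u *\<^sub>R f u)" using ginv_coordinate[OF _ c] by simp
  also have "\<dots> = f x" unfolding c by (rule linear_on_sum[OF V assms(1) finite_hbasis, symmetric]) simp
  finally show ?thesis .
qed

lemma ginv_commute:
  assumes "u \<in> hbasis" "w \<in> hbasis"
  shows "ginv u w = ginv w u"
proof -
  have *: "(\<Sum>t\<in>hbasis. ginv u t * g t v) = (if u = v then 1 else 0)" if "u \<in> hbasis" "v \<in> hbasis" for u v
    using inverse_gram_ginv that unfolding inverse_gram_def by blast
  have "ginv u w = (\<Sum>t\<in>hbasis. ginv u t * (if w = t then 1 else 0))"
    using assms finite_hbasis by (simp add: if_distrib[of "(*) _"] cong: if_cong)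
  also have "\<dots> = (\<Sum>t\<in>hbasis. ginv u t * (\<Sum>s\<in>hbasis. ginv w s * g s t))"
    using * assms by (intro sum.cong) auto
  also have "\<dots> = (\<Sum>t\<in>hbasis. \<Sum>s\<in>hbasis. ginv w s * (ginv u t * g t s))"
    by (simp add: sum_distrib_left mult.left_commute) (intro sum.cong refl, simp add: g_commute)
  also have "\<dots> = (\<Sum>s\<in>hbasis. ginv w s * (\<Sum>t\<in>hbasis. ginv u t * g t s))"
    by (subst sum.swap) (simp add: sum_distrib_left)
  also have "\<dots> = (\<Sum>s\<in>hbasis. ginv w s * (if u = s then 1 else 0))"
    using * assms by (intro sum.cong) auto
  also have "\<dots> = ginv w u"
    using assms finite_hbasis by (simp add: if_distrib[of "(*) _"] cong: if_cong)
  finally show ?thesis .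
qed

lemma ginv_contract':
  assumes "linear_on V f" "x \<in> H"
  shows "(\<Sum>u\<in>hbasis. \<Sum>w\<in>hbasis. ginv u w * (g u x * f w)) = f x"
proof -
  have "(\<Sum>u\<in>hbasis. \<Sum>w\<in>hbasis. ginv u w * (g u x * f w)) = (\<Sum>w\<in>hbasis. \<Sum>u\<in>hbasis. ginv w u * (g u x * f w))"
    by (subst sum.swap) (simp add: ginv_commute)
  then show ?thesis using ginv_contract[OF assms] by simp
qed

lemma ginv_trace_g: "(\<Sum>u\<in>hbasis. \<Sum>w\<in>hbasis. ginv u w * g u w) = 2 * real n"
proof -
  have "(\<Sum>u\<in>hbasis. \<Sum>w\<in>hbasis. ginv u w * g u w) = (\<Sum>u\<in>hbasis. \<Sum>w\<in>hbasis. ginv u w * g w u)"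
    by (simp add: g_commute)
  also have "\<dots> = (\<Sum>u\<in>hbasis. 1)" using inverse_gram_ginv by (simp add: inverse_gram_def)
  finally show ?thesis by (simp add: card_hbasis)
qed

text \<open>The contraction is the trace of \<open>\<phi>\<close> on \<open>H\<close>, where \<open>\<phi>\<close> is a complex structure.\<close>

lemma ginv_trace_phi: "(\<Sum>u\<in>hbasis. \<Sum>w\<in>hbasis. ginv u w * g u (\<phi> w)) = 0"
proof -
  have "(\<Sum>u\<in>hbasis. \<Sum>w\<in>hbasis. ginv u w * g u (\<phi> w)) = (\<Sum>u\<in>hbasis. \<Sum>w\<in>hbasis. ginv u w * g w (\<phi> u))"
    by (intro sum.cong refl) (metis hbasis_V g_commute g_phi phi_V)
  also have "\<dots> = (\<Sum>u\<in>hbasis. representation hbasis (\<phi> u) u)"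
  proof (rule sum.cong[OF refl])
    fix u assume u: "u \<in> hbasis"
    then have "\<phi> u \<in> span hbasis" using hbasis(2) by simp
    then have "\<phi> u = (\<Sum>t\<in>hbasis. representation hbasis (\<phi> u) t *\<^sub>R t)"
      using sum_representation_eq[OF hbasis(1) _ finite_hbasis] by simp
    from ginv_coordinate[OF u this] show "(\<Sum>w\<in>hbasis. ginv u w * g w (\<phi> u)) = representation hbasis (\<phi> u) u" .
  qed
  also have "\<dots> = 0"
    by (rule complex_structure_trace_zero[OF finite_hbasis hbasis(1)])
      (auto simp: hbasis(2) phi_phi linear_on_def phi_add phi_scaleR)
  finally show ?thesis .
qed

lemma lee_form_eq: "lee_form V \<eta> g F z = (\<Sum>u\<in>hbasis. \<Sum>w\<in>hbasis. ginv u w * F u w z)"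
  by (simp add: lee_form_def Let_def hbasis_def[symmetric] ginv_def[symmetric])

lemma lee_form_diff: "lee_form V \<eta> g (F - G) z = lee_form V \<eta> g F z - lee_form V \<eta> g G z"
  by (simp add: lee_form_eq algebra_simps sum_subtractf)

end

section \<open>Decomposition of tensors of type F\<close>

context almost_contact_B_metric_space
begin

abbreviation \<F> where "\<F> \<equiv> F_tensors V \<phi> \<xi> \<eta>"

definition zero_outside :: "('v \<Rightarrow> 'v \<Rightarrow> 'v \<Rightarrow> real) \<Rightarrow> 'v \<Rightarrow> 'v \<Rightarrow> 'v \<Rightarrow> real" where
  "zero_outside G x y z = (if x \<in> V \<and> y \<in> V \<and> z \<in> V then G x y z else 0)"

lemma zero_outside_eq [simp]: "x \<in> V \<Longrightarrow> y \<in> V \<Longrightarrow> z \<in> V \<Longrightarrow> zero_outside G x y z = G x y z"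
  by (simp add: zero_outside_def)

lemma F_tensorsI:
  assumes "\<And>x y. x \<in> V \<Longrightarrow> y \<in> V \<Longrightarrow> linear_on V (F x y)"
    and "\<And>y z. y \<in> V \<Longrightarrow> z \<in> V \<Longrightarrow> linear_on V (\<lambda>x. F x y z)"
    and sym: "\<And>x y z. x \<in> V \<Longrightarrow> y \<in> V \<Longrightarrow> z \<in> V \<Longrightarrow> F x y z = F x z y"
    and "\<And>x y z. \<not> (x \<in> V \<and> y \<in> V \<and> z \<in> V) \<Longrightarrow> F x y z = 0"
    and "\<And>x y z. x \<in> V \<Longrightarrow> y \<in> V \<Longrightarrow> z \<in> V \<Longrightarrow>
      F x y z = F x (\<phi> y) (\<phi> z) + \<eta> y * F x \<xi> z + \<eta> z * F x y \<xi>"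
  shows "F \<in> \<F>"
proof -
  have "linear_on V (\<lambda>y. F x y z)" if "x \<in> V" "z \<in> V" for x z
    using assms(1)[OF that] sym[OF that(1) _ that(2)] unfolding linear_on_def by simp
  then have "F \<in> tensors03 V"
    using assms(1,2,4) unfolding tensors03_def by simp
  then show ?thesis
    unfolding F_tensors_def by (intro CollectI conjI ballI sym assms(5))
qed

lemma F_tensorsD:
  assumes "F \<in> \<F>"
  shows F_add1: "x \<in> V \<Longrightarrow> x' \<in> V \<Longrightarrow> y \<in> V \<Longrightarrow> z \<in> V \<Longrightarrow> F (x + x') y z = F x y z + F x' y z"
    and F_scale1: "x \<in> V \<Longrightarrow> y \<in> V \<Longrightarrow> z \<in> V \<Longrightarrow> F (a *\<^sub>R x) y z = a * F x y z"
    and F_add2: "x \<in> V \<Longrightarrow> x' \<in> V \<Longrightarrow> y \<in> V \<Longrightarrow> z \<in> V \<Longrightarrow> F y (x + x') z = F y x z + F y x' z"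
    and F_scale2: "x \<in> V \<Longrightarrow> y \<in> V \<Longrightarrow> z \<in> V \<Longrightarrow> F y (a *\<^sub>R x) z = a * F y x z"
    and F_add3: "x \<in> V \<Longrightarrow> x' \<in> V \<Longrightarrow> y \<in> V \<Longrightarrow> z \<in> V \<Longrightarrow> F y z (x + x') = F y z x + F y z x'"
    and F_scale3: "x \<in> V \<Longrightarrow> y \<in> V \<Longrightarrow> z \<in> V \<Longrightarrow> F y z (a *\<^sub>R x) = a * F y z x"
    and F_sym: "x \<in> V \<Longrightarrow> y \<in> V \<Longrightarrow> z \<in> V \<Longrightarrow> F x y z = F x z y"
    and F_outside: "\<not> (x \<in> V \<and> y \<in> V \<and> z \<in> V) \<Longrightarrow> F x y z = 0"
    and F_phi: "x \<in> V \<Longrightarrow> y \<in> V \<Longrightarrow> z \<in> V \<Longrightarrow>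
      F x y z = F x (\<phi> y) (\<phi> z) + \<eta> y * F x \<xi> z + \<eta> z * F x y \<xi>"
proof -
  have T: "F \<in> tensors03 V"
    and S: "\<forall>x\<in>V. \<forall>y\<in>V. \<forall>z\<in>V. F x y z = F x z y \<and>
      F x y z = F x (\<phi> y) (\<phi> z) + \<eta> y * F x \<xi> z + \<eta> z * F x y \<xi>"
    using assms unfolding F_tensors_def mem_Collect_eq by (rule conjunct1, rule conjunct2)
  from T have L: "\<And>x y. x \<in> V \<Longrightarrow> y \<in> V \<Longrightarrow> linear_on V (\<lambda>z. F x y z)"
      "\<And>x z. x \<in> V \<Longrightarrow> z \<in> V \<Longrightarrow> linear_on V (\<lambda>y. F x y z)"
      "\<And>y z. y \<in> V \<Longrightarrow> z \<in> V \<Longrightarrow> linear_on V (\<lambda>x. F x y z)"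
      "\<And>x y z. \<not> (x \<in> V \<and> y \<in> V \<and> z \<in> V) \<Longrightarrow> F x y z = 0"
    unfolding tensors03_def by simp_all
  show "x \<in> V \<Longrightarrow> x' \<in> V \<Longrightarrow> y \<in> V \<Longrightarrow> z \<in> V \<Longrightarrow> F (x + x') y z = F x y z + F x' y z"
    using linear_on_add[OF L(3)] by simp
  show "x \<in> V \<Longrightarrow> y \<in> V \<Longrightarrow> z \<in> V \<Longrightarrow> F (a *\<^sub>R x) y z = a * F x y z"
    using linear_on_scaleR[OF L(3)] by simp
  show "x \<in> V \<Longrightarrow> x' \<in> V \<Longrightarrow> y \<in> V \<Longrightarrow> z \<in> V \<Longrightarrow> F y (x + x') z = F y x z + F y x' z"
    using linear_on_add[OF L(2)] by simp
  show "x \<in> V \<Longrightarrow> y \<in> V \<Longrightarrow> z \<in> V \<Longrightarrow> F y (a *\<^sub>R x) z = a * F y x z"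
    using linear_on_scaleR[OF L(2)] by simp
  show "x \<in> V \<Longrightarrow> x' \<in> V \<Longrightarrow> y \<in> V \<Longrightarrow> z \<in> V \<Longrightarrow> F y z (x + x') = F y z x + F y z x'"
    using linear_on_add[OF L(1)] by simp
  show "x \<in> V \<Longrightarrow> y \<in> V \<Longrightarrow> z \<in> V \<Longrightarrow> F y z (a *\<^sub>R x) = a * F y z x"
    using linear_on_scaleR[OF L(1)] by simp
  show "\<not> (x \<in> V \<and> y \<in> V \<and> z \<in> V) \<Longrightarrow> F x y z = 0"
    by (rule L(4))
  assume V: "x \<in> V" "y \<in> V" "z \<in> V"
  show "F x y z = F x z y"
    using S V by (meson conjunct1)
  show "F x y z = F x (\<phi> y) (\<phi> z) + \<eta> y * F x \<xi> z + \<eta> z * F x y \<xi>"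
    using S V by (meson conjunct2)
qed

lemma F_zero:
  assumes "F \<in> \<F>" "x \<in> V" "y \<in> V"
  shows "F 0 x y = 0" "F x 0 y = 0" "F x y 0 = 0"
  using F_scale1[OF assms(1) assms(2,2,3), of 0] F_scale2[OF assms(1) assms(2,2,3), of 0]
    F_scale3[OF assms(1) assms(2,2,3), of 0] by simp_all

lemma F_diff_mem:
  assumes "F \<in> \<F>" "G \<in> \<F>"
  shows "F - G \<in> \<F>"
proof (rule F_tensorsI)
  note D = F_tensorsD[OF assms(1)] F_tensorsD[OF assms(2)]
  show "linear_on V ((F - G) x y)" if "x \<in> V" "y \<in> V" for x y
    unfolding linear_on_def using that D(5,6,14,15) by (simp add: algebra_simps)
  show "linear_on V (\<lambda>x. (F - G) x y z)" if "y \<in> V" "z \<in> V" for y z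
    unfolding linear_on_def using that D(1,2,10,11) by (simp add: algebra_simps)
  show "(F - G) x y z = (F - G) x z y" if "x \<in> V" "y \<in> V" "z \<in> V" for x y z
    using that D(7,16) by simp
  show "(F - G) x y z = 0" if "\<not> (x \<in> V \<and> y \<in> V \<and> z \<in> V)" for x y z
    using that D(8,17) by simp
  show "(F - G) x y z = (F - G) x (\<phi> y) (\<phi> z) + \<eta> y * (F - G) x \<xi> z + \<eta> z * (F - G) x y \<xi>"
    if "x \<in> V" "y \<in> V" "z \<in> V" for x y z
    using that D(9)[of x y z] D(18)[of x y z] by (simp add: algebra_simps)
qed

text \<open>The right hand side of the defining equation of \<open>\<F>\<^sub>1\<close> with a prescribed 1-form \<open>\<theta>\<close> in
  place of the Lee form.\<close>

definition trace_part :: "('v \<Rightarrow> real) \<Rightarrow> 'v \<Rightarrow> 'v \<Rightarrow> 'v \<Rightarrow> real" where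
  "trace_part \<theta> = zero_outside (\<lambda>x y z. 1 / (2 * real n) *
      (g x (\<phi> y) * \<theta> (\<phi> z) + g (\<phi> x) (\<phi> y) * \<theta> (\<phi> (\<phi> z)) +
       g x (\<phi> z) * \<theta> (\<phi> y) + g (\<phi> x) (\<phi> z) * \<theta> (\<phi> (\<phi> y))))"

context
  fixes \<theta> :: "'v \<Rightarrow> real"
  assumes \<theta>: "linear_on V \<theta>" and \<theta>_xi: "\<theta> \<xi> = 0"
begin

lemma theta_zero [simp]: "\<theta> 0 = 0"
  using linear_on_scaleR[OF \<theta>, of 0 0] by simp

lemma theta_minus: "x \<in> V \<Longrightarrow> \<theta> (- x) = - \<theta> x"
  using linear_on_scaleR[OF \<theta>, of x "-1"] by simp

lemma theta_phi_phi: "x \<in> V \<Longrightarrow> \<theta> (\<phi> (\<phi> x)) = - \<theta> x"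
  by (simp only: phi_phi linear_on_add[OF \<theta>] V_closed xi_V theta_minus linear_on_scaleR[OF \<theta>] \<theta>_xi) simp

lemma trace_part_eq:
  "x \<in> V \<Longrightarrow> y \<in> V \<Longrightarrow> z \<in> V \<Longrightarrow> trace_part \<theta> x y z = 1 / (2 * real n) *
      (g x (\<phi> y) * \<theta> (\<phi> z) - g (\<phi> x) (\<phi> y) * \<theta> z +
       g x (\<phi> z) * \<theta> (\<phi> y) - g (\<phi> x) (\<phi> z) * \<theta> y)"
  by (simp add: trace_part_def theta_phi_phi)

lemma trace_part_mem: "trace_part \<theta> \<in> \<F>"
proof (rule F_tensorsI)
  note \<theta>l = linear_on_add[OF \<theta>] linear_on_scaleR[OF \<theta>]
  show "linear_on V (trace_part \<theta> x y)" if "x \<in> V" "y \<in> V" for x y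
    unfolding linear_on_def using that
    by (simp add: trace_part_eq \<theta>l phi_add phi_scaleR g_add_right g_scaleR_right)
      (simp add: algebra_simps add_divide_distrib diff_divide_distrib)
  show "linear_on V (\<lambda>x. trace_part \<theta> x y z)" if "y \<in> V" "z \<in> V" for y z
    unfolding linear_on_def using that
    by (simp add: trace_part_eq \<theta>l phi_add phi_scaleR g_add_left g_scaleR_left)
      (simp add: algebra_simps add_divide_distrib diff_divide_distrib)
  show "trace_part \<theta> x y z = 0" if "\<not> (x \<in> V \<and> y \<in> V \<and> z \<in> V)" for x y z
    using that by (auto simp: trace_part_def zero_outside_def)
  fix x y z assume V: "x \<in> V" "y \<in> V" "z \<in> V"
  show "trace_part \<theta> x y z = trace_part \<theta> x z y" using V by (simp add: trace_part_eq)
  have "g x (\<phi> (\<phi> y)) = g (\<phi> x) (\<phi> y)" "g x (\<phi> (\<phi> z)) = g (\<phi> x) (\<phi> z)"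
    "g (\<phi> x) (\<phi> (\<phi> y)) = - g x (\<phi> y)" "g (\<phi> x) (\<phi> (\<phi> z)) = - g x (\<phi> z)"
    using V by (simp_all add: g_phi phi_phi_phi g_minus_right)
  then show "trace_part \<theta> x y z
      = trace_part \<theta> x (\<phi> y) (\<phi> z) + \<eta> y * trace_part \<theta> x \<xi> z + \<eta> z * trace_part \<theta> x y \<xi>"
    using V by (simp add: trace_part_eq theta_phi_phi \<theta>_xi)
qed

lemma trace_part_xi:
  "y \<in> V \<Longrightarrow> z \<in> V \<Longrightarrow> trace_part \<theta> \<xi> y z = 0"
  "x \<in> V \<Longrightarrow> z \<in> V \<Longrightarrow> trace_part \<theta> x \<xi> z = 0"
  by (simp_all add: trace_part_eq g_xi' \<theta>_xi)

lemma trace_part_cyclic: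
  assumes "x \<in> V" "y \<in> V" "z \<in> V"
  shows "trace_part \<theta> x y (\<phi> z) + trace_part \<theta> y z (\<phi> x) + trace_part \<theta> z x (\<phi> y) = 0"
proof -
  have c: "g y (\<phi> x) = g x (\<phi> y)" "g z (\<phi> y) = g y (\<phi> z)" "g z (\<phi> x) = g x (\<phi> z)"
    "g (\<phi> y) (\<phi> x) = g (\<phi> x) (\<phi> y)" "g (\<phi> z) (\<phi> y) = g (\<phi> y) (\<phi> z)" "g (\<phi> z) (\<phi> x) = g (\<phi> x) (\<phi> z)"
    using assms by (metis g_commute g_phi phi_V)+
  have t: "trace_part \<theta> u v (\<phi> w) = 1 / (2 * real n) *
      (g u (\<phi> w) * \<theta> v - g u (\<phi> v) * \<theta> w + g (\<phi> u) (\<phi> w) * \<theta> (\<phi> v) - g (\<phi> u) (\<phi> v) * \<theta> (\<phi> w))"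
    if V: "u \<in> V" "v \<in> V" "w \<in> V" for u v w
  proof -
    have "g u (\<phi> (\<phi> w)) = g (\<phi> u) (\<phi> w)" using V by (simp add: g_phi)
    moreover have "g (\<phi> u) (\<phi> (\<phi> w)) = - g u (\<phi> w)"
      using V by (simp add: g_phi phi_phi_phi g_minus_right)
    ultimately show ?thesis using V by (simp add: trace_part_eq theta_phi_phi)
  qed
  show ?thesis
    using assms unfolding t[OF assms] t[OF assms(2,3,1)] t[OF assms(3,1,2)] c
    by (simp add: add_divide_distrib diff_divide_distrib)
qed

text \<open>With \<open>dim H = 2n\<close> the term containing \<open>g(\<phi>x, \<phi>y)\<close> contributes \<open>\<theta>\<close>, the first term contributes
  a multiple of the trace of \<open>\<phi>\<close>, and the contributions of the last two cancel.\<close>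

lemma lee_form_trace_part:
  assumes z: "z \<in> V"
  shows "lee_form V \<eta> g (trace_part \<theta>) z = \<theta> z"
proof -
  let ?S = "\<lambda>f. \<Sum>u\<in>hbasis. \<Sum>w\<in>hbasis. ginv u w * f u w"
  have t: "trace_part \<theta> u w z = 1 / (2 * real n) *
      (\<theta> (\<phi> z) * g u (\<phi> w) + \<theta> z * g u w + g u (\<phi> z) * \<theta> (\<phi> w) - g u (\<phi> (\<phi> z)) * \<theta> w)"
    if "u \<in> hbasis" "w \<in> hbasis" for u w
    using that z by (simp add: trace_part_eq g_phi_phi[of u w] g_phi[of u "\<phi> z"] mult.commute)
  have "lee_form V \<eta> g (trace_part \<theta>) z = 1 / (2 * real n) *
     (\<theta> (\<phi> z) * ?S (\<lambda>u w. g u (\<phi> w)) + \<theta> z * ?S g +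
      ?S (\<lambda>u w. g u (\<phi> z) * \<theta> (\<phi> w)) - ?S (\<lambda>u w. g u (\<phi> (\<phi> z)) * \<theta> w))"
  proof -
    have "lee_form V \<eta> g (trace_part \<theta>) z = (\<Sum>u\<in>hbasis. \<Sum>w\<in>hbasis. 1 / (2 * real n) *
      (\<theta> (\<phi> z) * (ginv u w * g u (\<phi> w)) + \<theta> z * (ginv u w * g u w) +
       ginv u w * (g u (\<phi> z) * \<theta> (\<phi> w)) - ginv u w * (g u (\<phi> (\<phi> z)) * \<theta> w)))"
      unfolding lee_form_eq by (intro sum.cong refl) (simp add: t algebra_simps)
    also have "\<dots> = 1 / (2 * real n) * (\<Sum>u\<in>hbasis. \<Sum>w\<in>hbasis.
      (\<theta> (\<phi> z) * (ginv u w * g u (\<phi> w)) + \<theta> z * (ginv u w * g u w) +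
       ginv u w * (g u (\<phi> z) * \<theta> (\<phi> w)) - ginv u w * (g u (\<phi> (\<phi> z)) * \<theta> w)))"
      by (simp only: sum_distrib_left)
    finally show ?thesis
      by (simp only: sum_subtractf sum.distrib sum_distrib_left[symmetric])
  qed
  moreover have "?S (\<lambda>u w. g u (\<phi> z) * \<theta> (\<phi> w)) = - \<theta> z"
  proof -
    have "linear_on V (\<lambda>w. \<theta> (\<phi> w))"
      using linear_on_add[OF \<theta>] linear_on_scaleR[OF \<theta>] by (simp add: linear_on_def phi_add phi_scaleR)
    from ginv_contract'[OF this, of "\<phi> z"] show ?thesis using z by (simp add: theta_phi_phi)
  qed
  moreover have "?S (\<lambda>u w. g u (\<phi> (\<phi> z)) * \<theta> w) = - \<theta> z"
    using ginv_contract'[OF \<theta>, of "\<phi> (\<phi> z)"] z by (simp add: theta_phi_phi)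
  ultimately show ?thesis using n_pos by (simp add: ginv_trace_phi ginv_trace_g)
qed

lemma trace_part_F1: "trace_part \<theta> \<in> class_F1 V n \<phi> \<xi> \<eta> g"
  using trace_part_mem
  by (simp add: class_F1_def Let_def lee_form_trace_part) (simp add: trace_part_def)

end

text \<open>Tensors of type F that live on \<open>H\<close>; vanishing on \<open>\<xi>\<close> in the third argument follows by
  symmetry.\<close>

definition horizontal_tensors :: "('v \<Rightarrow> 'v \<Rightarrow> 'v \<Rightarrow> real) set" where
  "horizontal_tensors = {F \<in> \<F>.
    (\<forall>y\<in>V. \<forall>z\<in>V. F \<xi> y z = 0) \<and> (\<forall>x\<in>V. \<forall>z\<in>V. F x \<xi> z = 0)}"

lemma horizontal_tensorsD:
  assumes "F \<in> horizontal_tensors"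
  shows "F \<in> \<F>" "y \<in> V \<Longrightarrow> z \<in> V \<Longrightarrow> F \<xi> y z = 0" "x \<in> V \<Longrightarrow> z \<in> V \<Longrightarrow> F x \<xi> z = 0"
  using assms by (simp_all add: horizontal_tensors_def)

lemma horizontal_tensorsI:
  "F \<in> \<F> \<Longrightarrow> (\<And>y z. y \<in> V \<Longrightarrow> z \<in> V \<Longrightarrow> F \<xi> y z = 0) \<Longrightarrow>
   (\<And>x z. x \<in> V \<Longrightarrow> z \<in> V \<Longrightarrow> F x \<xi> z = 0) \<Longrightarrow> F \<in> horizontal_tensors"
  by (simp add: horizontal_tensors_def)

text \<open>The tensor of type \<open>\<F>\<^sub>1\<close> with the Lee form of \<open>P\<close> satisfies the same cyclic identity as \<open>P\<close>,
  so that subtracting it leaves a tensor of type \<open>\<F>\<^sub>2\<close>.\<close>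

lemma F1_F2_decomposition:
  assumes hor: "P \<in> horizontal_tensors"
    and cyc: "\<forall>x\<in>V. \<forall>y\<in>V. \<forall>z\<in>V. P x y (\<phi> z) + P y z (\<phi> x) + P z x (\<phi> y) = 0"
  obtains F1 F2 where "F1 \<in> class_F1 V n \<phi> \<xi> \<eta> g" "F2 \<in> class_F2 V \<phi> \<xi> \<eta> g" "P = F1 + F2"
proof -
  note P = horizontal_tensorsD(1)[OF hor] and P1 = horizontal_tensorsD(2)[OF hor]
    and P2 = horizontal_tensorsD(3)[OF hor]
  define \<theta> where "\<theta> = lee_form V \<eta> g P"
  have lin: "linear_on V \<theta>"
    unfolding linear_on_def \<theta>_def lee_form_eq
    by (simp add: F_add3[OF P] F_scale3[OF P] ring_distribs sum.distrib sum_distrib_left mult.left_commute)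
  have xi: "\<theta> \<xi> = 0"
    unfolding \<theta>_def lee_form_eq by (simp add: F_sym[OF P, of _ _ \<xi>] P2)
  let ?F1 = "trace_part \<theta>"
  have "P - ?F1 \<in> class_F2 V \<phi> \<xi> \<eta> g"
    unfolding class_F2_def
  proof (intro CollectI conjI ballI)
    show "P - ?F1 \<in> \<F>" by (rule F_diff_mem[OF P trace_part_mem[OF lin xi]])
    fix y z assume V: "y \<in> V" "z \<in> V"
    show "(P - ?F1) \<xi> y z = 0" "(P - ?F1) y \<xi> z = 0"
      using V P1 P2 trace_part_xi[OF lin xi] by simp_all
    show "lee_form V \<eta> g (P - ?F1) z = 0"
      using V lee_form_trace_part[OF lin xi] by (simp add: lee_form_diff \<theta>_def[symmetric])
    fix x assume "x \<in> V"
    from bspec[OF bspec[OF bspec[OF cyc this] V(1)] V(2)] trace_part_cyclic[OF lin xi this V]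
    show "(P - ?F1) x y (\<phi> z) + (P - ?F1) y z (\<phi> x) + (P - ?F1) z x (\<phi> y) = 0" by simp
  qed
  moreover have "P = ?F1 + (P - ?F1)" by simp
  ultimately show ?thesis by (rule that[OF trace_part_F1[OF lin xi]])
qed

text \<open>Let \<open>A\<close> be the cyclic sum of \<open>F\<close>, a totally symmetric tensor. In the complexification
  \<open>A\<close> is twice the symmetric part of \<open>F\<close> when \<open>y\<close> and \<open>z\<close> have different type and \<open>x\<close> has the
  type of one of them, but \<open>A\<close> also has components with \<open>y\<close> and \<open>z\<close> of the same type, which a
  tensor of type F may not have. Adding \<open>A(x, \<phi>y, \<phi>z)\<close> doubles the former and removes the
  latter, hence the factor \<open>1/4\<close> in \<open>P\<close>.\<close>

lemma horizontal_decomposition: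
  assumes hor: "F \<in> horizontal_tensors"
  obtains P F3 where "P \<in> horizontal_tensors" "F3 \<in> class_F3 V \<phi> \<xi> \<eta>" "F = P + F3"
    "\<forall>x\<in>V. \<forall>y\<in>V. \<forall>z\<in>V. P x y (\<phi> z) + P y z (\<phi> x) + P z x (\<phi> y) = 0"
proof -
  note F = horizontal_tensorsD(1)[OF hor] and F1 = horizontal_tensorsD(2)[OF hor]
    and F2 = horizontal_tensorsD(3)[OF hor]
  note D = F_tensorsD[OF F]
  have F3: "F x y \<xi> = 0" if "x \<in> V" "y \<in> V" for x y
    using F2[OF that] F_sym[OF F that, of \<xi>] by simp
  have Fphi: "F x (\<phi> y) (\<phi> z) = F x y z" if "x \<in> V" "y \<in> V" "z \<in> V" for x y z
    using F_phi[OF F that] F2 F3 that by simp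
  define A where "A x y z = F x y z + F y z x + F z x y" for x y z
  have A_add: "A x y (z + z') = A x y z + A x y z'"
    if "x \<in> V" "y \<in> V" "z \<in> V" "z' \<in> V" for x y z z'
    using that by (simp add: A_def D(1-6))
  have A_scale: "A x y (a *\<^sub>R z) = a * A x y z" if "x \<in> V" "y \<in> V" "z \<in> V" for x y z a
    using that by (simp add: A_def D(1-6) algebra_simps)
  have A_swap: "A x y z = A x z y" "A x y z = A y z x" if "x \<in> V" "y \<in> V" "z \<in> V" for x y z
    using that F_sym[OF F, of x y z] F_sym[OF F, of y z x] F_sym[OF F, of z x y] by (simp_all add: A_def)
  have A_xi: "A x y \<xi> = 0" if "x \<in> V" "y \<in> V" for x y
    using that F1 F2 F3 by (simp add: A_def)
  have A_zero: "A x 0 z = 0" "A x y 0 = 0" if "x \<in> V" "y \<in> V" "z \<in> V" for x y z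
    using that by (simp_all add: A_def F_zero[OF F])
  have A_phi_phi: "A x y (\<phi> (\<phi> z)) = - A x y z" if "x \<in> V" "y \<in> V" "z \<in> V" for x y z
  proof -
    have "A x y (\<phi> (\<phi> z)) = A x y ((-1) *\<^sub>R z + \<eta> z *\<^sub>R \<xi>)" using that by (simp add: phi_phi)
    also have "\<dots> = - A x y z"
      using that A_add[of x y "(-1) *\<^sub>R z" "\<eta> z *\<^sub>R \<xi>"] A_scale[of x y z "-1"]
        A_scale[of x y \<xi> "\<eta> z"] A_xi[of x y] by simp
    finally show ?thesis .
  qed
  have A_phi_phi': "A x (\<phi> (\<phi> y)) z = - A x y z" if "x \<in> V" "y \<in> V" "z \<in> V" for x y z
    using A_phi_phi[OF that(1,3,2)] A_swap(1)[of x "\<phi> (\<phi> y)" z] A_swap(1)[OF that] that by simp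
  \<comment> \<open>This identity makes the cyclic sum of \<open>P\<close> equal to \<open>A\<close>, the cyclic sum of \<open>F\<close>.\<close>
  have A_phi: "A x (\<phi> y) (\<phi> z) + A y (\<phi> z) (\<phi> x) + A z (\<phi> x) (\<phi> y) = A x y z"
    if V: "x \<in> V" "y \<in> V" "z \<in> V" for x y z
  proof -
    have mv: "F u (\<phi> v) w = - F u v (\<phi> w)" if "u \<in> V" "v \<in> V" "w \<in> V" for u v w
    proof -
      have "F u (\<phi> v) w = F u (\<phi> (\<phi> v)) (\<phi> w)" using Fphi[of u "\<phi> v" w] that by simp
      also have "\<dots> = F u ((-1) *\<^sub>R v + \<eta> v *\<^sub>R \<xi>) (\<phi> w)" using that by (simp add: phi_phi)
      also have "\<dots> = - F u v (\<phi> w)"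
        using that F2 D(3)[of "(-1) *\<^sub>R v" "\<eta> v *\<^sub>R \<xi>" u "\<phi> w"] D(4)[of v u "\<phi> w" "-1"]
          D(4)[of \<xi> u "\<phi> w" "\<eta> v"] by simp
      finally show ?thesis .
    qed
    have "F (\<phi> y) (\<phi> z) x = - F (\<phi> y) z (\<phi> x)" "F (\<phi> z) (\<phi> x) y = - F (\<phi> z) x (\<phi> y)"
      "F (\<phi> x) (\<phi> y) z = - F (\<phi> x) y (\<phi> z)"
      using V by (simp_all add: mv)
    then show ?thesis unfolding A_def using V by (simp add: Fphi)
  qed
  define P where "P = zero_outside (\<lambda>x y z. (A x y z + A x (\<phi> y) (\<phi> z)) / 4)"
  have P_eq: "P x y z = (A x y z + A x (\<phi> y) (\<phi> z)) / 4" if "x \<in> V" "y \<in> V" "z \<in> V" for x y z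
    using that by (simp add: P_def)
  have PF: "P \<in> \<F>"
  proof (rule F_tensorsI)
    show "linear_on V (P x y)" if "x \<in> V" "y \<in> V" for x y
      unfolding linear_on_def using that
      by (simp add: P_eq A_add A_scale phi_add phi_scaleR) (simp add: field_simps)
    show "linear_on V (\<lambda>x. P x y z)" if "y \<in> V" "z \<in> V" for y z
    proof -
      have e: "P x y z = (A y z x + A (\<phi> y) (\<phi> z) x) / 4" if "x \<in> V" for x
        using that \<open>y \<in> V\<close> \<open>z \<in> V\<close> A_swap(2)[of x y z] A_swap(2)[of x "\<phi> y" "\<phi> z"]
        by (simp add: P_eq)
      show ?thesis
        unfolding linear_on_def using that
        by (simp add: e A_add A_scale) (simp add: field_simps)
    qed
    show "P x y z = 0" if "\<not> (x \<in> V \<and> y \<in> V \<and> z \<in> V)" for x y z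
      using that by (auto simp: P_def zero_outside_def)
    fix x y z assume V: "x \<in> V" "y \<in> V" "z \<in> V"
    show "P x y z = P x z y"
      using V A_swap(1)[of x y z] A_swap(1)[of x "\<phi> y" "\<phi> z"] by (simp add: P_eq)
    have "A x \<xi> z = 0" "A x y \<xi> = 0" using V A_swap(1)[of x \<xi> z] A_xi by simp_all
    then show "P x y z = P x (\<phi> y) (\<phi> z) + \<eta> y * P x \<xi> z + \<eta> z * P x y \<xi>"
      using V by (simp add: P_eq A_phi_phi A_phi_phi' A_zero)
  qed
  have P1: "P \<xi> y z = 0" if "y \<in> V" "z \<in> V" for y z
    using that A_swap(2)[of \<xi> y z] A_swap(2)[of \<xi> "\<phi> y" "\<phi> z"] A_xi by (simp add: P_eq)
  have P2: "P x \<xi> z = 0" if "x \<in> V" "z \<in> V" for x z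
    using that A_swap(1)[of x \<xi> z] A_xi by (simp add: P_eq A_zero)
  have Pcyc: "P x y (\<phi> z) + P y z (\<phi> x) + P z x (\<phi> y) = 0" if V: "x \<in> V" "y \<in> V" "z \<in> V" for x y z
  proof -
    have "A y (\<phi> z) x = A x y (\<phi> z)" "A z (\<phi> x) y = A y z (\<phi> x)" "A x (\<phi> y) z = A z x (\<phi> y)"
      using V A_swap(2)[of x y "\<phi> z"] A_swap(2)[of y z "\<phi> x"] A_swap(2)[of z x "\<phi> y"] by simp_all
    then show ?thesis using V by (simp add: P_eq A_phi_phi diff_divide_distrib)
  qed
  have "F - P \<in> class_F3 V \<phi> \<xi> \<eta>"
  proof -
    have "(F - P) x y z + (F - P) y z x + (F - P) z x y = 0" if V: "x \<in> V" "y \<in> V" "z \<in> V" for x y z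
    proof -
      have "A y z x = A x y z" "A z x y = A x y z"
        using V A_swap(2)[of x y z] A_swap(2)[of y z x] by simp_all
      then have "P x y z + P y z x + P z x y = (3 * A x y z + A x y z) / 4"
        unfolding P_eq[OF V] P_eq[OF V(2,3,1)] P_eq[OF V(3,1,2)] A_phi[OF V, symmetric]
        by (simp add: field_simps)
      then show ?thesis by (simp add: A_def)
    qed
    moreover have "F - P \<in> \<F>" by (rule F_diff_mem[OF F PF])
    moreover have "(F - P) \<xi> y z = 0" "(F - P) y \<xi> z = 0" if "y \<in> V" "z \<in> V" for y z
      using that F1 F2 P1 P2 by simp_all
    ultimately show ?thesis unfolding class_F3_def by (intro CollectI conjI ballI)
  qed
  moreover have "F = P + (F - P)" by simp
  moreover have "P \<in> horizontal_tensors" by (rule horizontal_tensorsI[OF PF P1 P2])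
  ultimately show ?thesis using that Pcyc by simp
qed

text \<open>Vanishing on \<open>\<xi>\<close> in the second argument holds in \<open>\<F>\<^sub>1\<close> and \<open>\<F>\<^sub>1\<^sub>0\<close> because \<open>y\<close> enters only
  through \<open>\<phi> y\<close>. Conversely, the condition makes \<open>\<eta>(x) F(\<xi>, y, z)\<close> a tensor of type \<open>\<F>\<^sub>1\<^sub>0\<close> and
  the difference horizontal.\<close>

theorem class_U1_iff:
  assumes F: "F \<in> \<F>"
  shows "F \<in> class_U1 V n \<phi> \<xi> \<eta> g \<longleftrightarrow> (\<forall>x\<in>V. \<forall>z\<in>V. F x \<xi> z = 0)"
proof
  assume "F \<in> class_U1 V n \<phi> \<xi> \<eta> g"
  then obtain F1 F2 F3 F10 where FF: "F = F1 + F2 + F3 + F10" and c: "F1 \<in> class_F1 V n \<phi> \<xi> \<eta> g"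
    "F2 \<in> class_F2 V \<phi> \<xi> \<eta> g" "F3 \<in> class_F3 V \<phi> \<xi> \<eta>" "F10 \<in> class_F10 V \<phi> \<xi> \<eta>"
    unfolding class_U1_def by blast
  have "F1 \<in> \<F>" "F10 \<in> \<F>" using c(1,4) by (auto simp: class_F1_def class_F10_def Let_def)
  have l0: "lee_form V \<eta> g F1 0 = 0"
    by (simp add: lee_form_eq F_zero[OF \<open>F1 \<in> \<F>\<close>])
  show "\<forall>x\<in>V. \<forall>z\<in>V. F x \<xi> z = 0"
  proof (intro ballI)
    fix x z assume V: "x \<in> V" "z \<in> V"
    have "F1 x \<xi> z = 0" using c(1) V l0 by (simp add: class_F1_def Let_def)
    moreover have "F2 x \<xi> z = 0" "F3 x \<xi> z = 0" using c(2,3) V by (auto simp: class_F2_def class_F3_def)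
    moreover have "F10 x \<xi> z = 0" using c(4) V F_zero[OF \<open>F10 \<in> \<F>\<close>] by (simp add: class_F10_def)
    ultimately show "F x \<xi> z = 0" by (simp add: FF)
  qed
next
  assume vert: "\<forall>x\<in>V. \<forall>z\<in>V. F x \<xi> z = 0"
  define F10 where "F10 = zero_outside (\<lambda>x y z. \<eta> x * F \<xi> y z)"
  have xi3: "F x y \<xi> = 0" if "x \<in> V" "y \<in> V" for x y
    using vert F_sym[OF F that, of \<xi>] that by simp
  have Fphi: "F x (\<phi> y) (\<phi> z) = F x y z" if "x \<in> V" "y \<in> V" "z \<in> V" for x y z
    using F_phi[OF F that] vert xi3 that by simp
  have F10: "F10 \<in> \<F>"
  proof (rule F_tensorsI)
    show "linear_on V (F10 x y)" if "x \<in> V" "y \<in> V" for x y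
      unfolding linear_on_def using that
      by (simp add: F10_def F_add3[OF F] F_scale3[OF F] algebra_simps)
    show "linear_on V (\<lambda>x. F10 x y z)" if "y \<in> V" "z \<in> V" for y z
      unfolding linear_on_def using that by (simp add: F10_def eta_add eta_scaleR algebra_simps)
    show "F10 x y z = 0" if "\<not> (x \<in> V \<and> y \<in> V \<and> z \<in> V)" for x y z
      using that by (auto simp: F10_def zero_outside_def)
    fix x y z assume V: "x \<in> V" "y \<in> V" "z \<in> V"
    show "F10 x y z = F10 x z y" using V F_sym[OF F, of \<xi> y z] by (simp add: F10_def)
    show "F10 x y z = F10 x (\<phi> y) (\<phi> z) + \<eta> y * F10 x \<xi> z + \<eta> z * F10 x y \<xi>"
      using V vert xi3 by (simp add: F10_def Fphi)
  qed
  then have c10: "F10 \<in> class_F10 V \<phi> \<xi> \<eta>"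
    using Fphi by (simp add: class_F10_def F10_def)
  have "F - F10 \<in> horizontal_tensors"
    by (rule horizontal_tensorsI[OF F_diff_mem[OF F F10]]) (use vert in \<open>simp_all add: F10_def\<close>)
  then obtain P F3 where P: "P \<in> horizontal_tensors" "F3 \<in> class_F3 V \<phi> \<xi> \<eta>" "F - F10 = P + F3"
    "\<forall>x\<in>V. \<forall>y\<in>V. \<forall>z\<in>V. P x y (\<phi> z) + P y z (\<phi> x) + P z x (\<phi> y) = 0"
    by (rule horizontal_decomposition)
  obtain F1 F2 where F12: "F1 \<in> class_F1 V n \<phi> \<xi> \<eta> g" "F2 \<in> class_F2 V \<phi> \<xi> \<eta> g" "P = F1 + F2"
    using F1_F2_decomposition[OF P(1,4)] .
  have "F = F1 + F2 + F3 + F10" using P(3) F12(3) by (simp add: algebra_simps)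
  then show "F \<in> class_U1 V n \<phi> \<xi> \<eta> g"
    unfolding class_U1_def using F12(1,2) P(2) c10 by (intro CollectI exI conjI)
qed

end

section \<open>Smooth functions and vector fields\<close>

context smooth_manifold
begin

lemma chart:
  assumes "(U, c) \<in> A"
  shows chart_open: "open U" and chart_image_open: "open (c ` U)"
    and chart_inverse: "q \<in> U \<Longrightarrow> inv_into U c (c q) = q"
    and chart_inverse_continuous: "continuous_on (c ` U) (inv_into U c)"
proof -
  have *: "homeomorphism U (c ` U) c (inv_into U c)" and "open U" "open (c ` U)"
    using charts_homeomorphism[OF assms] by auto
  then show "open U" "open (c ` U)" by auto
  show "q \<in> U \<Longrightarrow> inv_into U c (c q) = q" by (rule homeomorphism_apply1[OF *])
  show "continuous_on (c ` U) (inv_into U c)" by (rule homeomorphism_cont2[OF *])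
qed

lemma chart_open_image:
  assumes "(U, c) \<in> A" "open W" "W \<subseteq> U"
  shows "open (c ` W)"
proof -
  have "open (inv_into U c -` W \<inter> c ` U)"
    using continuous_on_open_vimage[OF chart_image_open[OF assms(1)]]
      chart_inverse_continuous[OF assms(1)] assms(2) by blast
  moreover have "inv_into U c -` W \<inter> c ` U = c ` W"
    using assms(3) chart_inverse[OF assms(1)] by (auto simp: image_iff subset_iff) 
  ultimately show ?thesis by simp
qed

lemma smooth_functionsI:
  "(\<And>U c. (U, c) \<in> A \<Longrightarrow> smooth_on (c ` U) (f \<circ> inv_into U c)) \<Longrightarrow> f \<in> smooth_functions A"
  by (auto simp: smooth_functions_def)

lemma smooth_functionsD:
  "f \<in> smooth_functions A \<Longrightarrow> (U, c) \<in> A \<Longrightarrow> smooth_on (c ` U) (f \<circ> inv_into U c)"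
  by (auto simp: smooth_functions_def)

lemma smooth_functions_add:
  assumes "f \<in> smooth_functions A" "h \<in> smooth_functions A"
  shows "(\<lambda>q. f q + h q) \<in> smooth_functions A"
  using smooth_on_add[OF chart_image_open smooth_functionsD[OF assms(1)] smooth_functionsD[OF assms(2)]]
  by (intro smooth_functionsI) (simp add: comp_def)

lemma smooth_functions_mult:
  assumes "f \<in> smooth_functions A" "h \<in> smooth_functions A"
  shows "(\<lambda>q. f q * h q) \<in> smooth_functions A"
  using smooth_on_mult[OF chart_image_open smooth_functionsD[OF assms(1)] smooth_functionsD[OF assms(2)]]
  by (intro smooth_functionsI) (simp add: comp_def)

lemma smooth_functions_const: "(\<lambda>q. a) \<in> smooth_functions A"
  by (intro smooth_functionsI) (simp add: comp_def smooth_on_const chart_image_open)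

lemma smooth_functions_minus:
  "f \<in> smooth_functions A \<Longrightarrow> (\<lambda>q. - f q) \<in> smooth_functions A"
  using smooth_functions_mult[OF smooth_functions_const[of "-1"], of f] by simp

lemma smooth_functions_diff:
  "f \<in> smooth_functions A \<Longrightarrow> h \<in> smooth_functions A \<Longrightarrow> (\<lambda>q. f q - h q) \<in> smooth_functions A"
  using smooth_functions_add[OF _ smooth_functions_minus, of f h] by simp

text \<open>Extension by zero of a function that is supported in a compact part of a chart. The
  support is closed in the manifold because the manifold is Hausdorff, so each point outside of
  the chart has a neighbourhood on which the extension vanishes.\<close>

lemma smooth_function_from_chart:
  assumes U: "(U, c) \<in> A" and K: "compact K" "K \<subseteq> c ` U"
    and \<Phi>: "smooth_on (c ` U) \<Phi>" and zero: "\<And>x. x \<in> c ` U \<Longrightarrow> x \<notin> K \<Longrightarrow> \<Phi> x = 0"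
  shows "(\<lambda>q. if q \<in> U then \<Phi> (c q) else 0) \<in> smooth_functions A" (is "?f \<in> _")
proof (rule smooth_functionsI)
  fix W d assume W: "(W, d) \<in> A"
  define K' where "K' = inv_into U c ` K"
  have "compact K'"
    unfolding K'_def
    using K chart_inverse_continuous[OF U] by (blast intro: compact_continuous_image continuous_on_subset)
  then have "closed K'" by (rule compact_imp_closed)
  show "smooth_on (d ` W) (?f \<circ> inv_into W d)"
  proof (rule smooth_on_local)
    fix x assume "x \<in> d ` W"
    then obtain q where q: "q \<in> W" "x = d q" by blast
    show "\<exists>T. open T \<and> x \<in> T \<and> smooth_on T (?f \<circ> inv_into W d)"
    proof (cases "q \<in> U")
      case True
      let ?T = "d ` (W \<inter> U)"
      have T: "open ?T"
        using chart_open_image[OF W, of "W \<inter> U"] chart_open[OF U] chart_open[OF W] by auto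
      have "(c \<circ> inv_into W d) ` ?T \<subseteq> c ` U"
        using chart_inverse[OF W] by auto
      then have "smooth_on ?T (\<lambda>y. \<Phi> ((c \<circ> inv_into W d) y))"
        by (rule smooth_on_compose[OF T chart_image_open[OF U] _ charts_compatible[OF W U] \<Phi>])
      then have "smooth_on ?T (?f \<circ> inv_into W d)"
        by (rule smooth_on_cong[OF T, rotated]) (use chart_inverse[OF W] in auto)
      then show ?thesis using T q True by blast
    next
      case False
      let ?T = "d ` (W - K')"
      have T: "open ?T"
        using chart_open_image[OF W, of "W - K'"] chart_open[OF W] \<open>closed K'\<close> by (auto simp: open_Diff)
      have "smooth_on ?T (?f \<circ> inv_into W d)"
      proof (rule smooth_on_cong[OF T _ smooth_on_const[OF T, of 0]])
        fix y assume "y \<in> ?T"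
        then obtain r where r: "r \<in> W" "r \<notin> K'" "y = d r" by blast
        have "\<Phi> (c r) = 0" if "r \<in> U"
          by (rule zero) (use that r(2) chart_inverse[OF U that] in \<open>force simp: K'_def\<close>)+
        then show "0 = (?f \<circ> inv_into W d) y" using r chart_inverse[OF W] by simp
      qed
      moreover have "q \<notin> K'"
        using False K(2) chart_inverse[OF U] by (auto simp: K'_def)
      ultimately show ?thesis using T q by blast
    qed
  qed
qed

lemma tangent_spaceI:
  assumes "\<And>f h. f \<in> smooth_functions A \<Longrightarrow> h \<in> smooth_functions A \<Longrightarrow> v (\<lambda>q. f q + h q) = v f + v h"
    and "\<And>a f. f \<in> smooth_functions A \<Longrightarrow> v (\<lambda>q. a * f q) = a * v f"
    and "\<And>f h. f \<in> smooth_functions A \<Longrightarrow> h \<in> smooth_functions A \<Longrightarrow>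
        v (\<lambda>q. f q * h q) = f p * v h + h p * v f"
    and "\<And>f. f \<notin> smooth_functions A \<Longrightarrow> v f = 0"
  shows "v \<in> tangent_space A p"
  using assms by (simp add: tangent_space_def)

lemma subspace_tangent_space: "subspace (tangent_space A p)"
proof (rule subspaceI)
  show "0 \<in> tangent_space A p"
    by (simp add: tangent_space_def)
  show "v + w \<in> tangent_space A p" if "v \<in> tangent_space A p" "w \<in> tangent_space A p" for v w
    using that by (simp add: tangent_space_def algebra_simps)
  show "a *\<^sub>R v \<in> tangent_space A p" if "v \<in> tangent_space A p" for v a
    using that by (simp add: tangent_space_def scaleR_fun_def algebra_simps)
qed

lemma vector_fieldsI:
  "(\<And>p. X p \<in> tangent_space A p) \<Longrightarrow>
   (\<And>f. f \<in> smooth_functions A \<Longrightarrow> (\<lambda>p. X p f) \<in> smooth_functions A) \<Longrightarrow> X \<in> vector_fields A"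
  by (simp add: vector_fields_def)

lemma vector_fieldsD:
  assumes "X \<in> vector_fields A"
  shows vector_field_tangent: "X p \<in> tangent_space A p"
    and vector_field_smooth: "f \<in> smooth_functions A \<Longrightarrow> (\<lambda>p. X p f) \<in> smooth_functions A"
  using assms by (auto simp: vector_fields_def)

lemma vector_fields_add:
  assumes "X \<in> vector_fields A" "Y \<in> vector_fields A"
  shows "X + Y \<in> vector_fields A"
proof (rule vector_fieldsI)
  show "(X + Y) p \<in> tangent_space A p" for p
    using assms by (simp add: vector_field_tangent subspace_add subspace_tangent_space)
  show "(\<lambda>p. (X + Y) p f) \<in> smooth_functions A" if "f \<in> smooth_functions A" for f
    using smooth_functions_add[OF vector_field_smooth[OF assms(1) that] vector_field_smooth[OF assms(2) that]]
    by simp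
qed

lemma vector_fields_scale:
  assumes "f \<in> smooth_functions A" "X \<in> vector_fields A"
  shows "(\<lambda>p. f p *\<^sub>R X p) \<in> vector_fields A"
proof (rule vector_fieldsI)
  show "f p *\<^sub>R X p \<in> tangent_space A p" for p
    using assms by (simp add: vector_field_tangent subspace_scale subspace_tangent_space)
  show "(\<lambda>p. (f p *\<^sub>R X p) h) \<in> smooth_functions A" if "h \<in> smooth_functions A" for h
    using smooth_functions_mult[OF assms(1) vector_field_smooth[OF assms(2) that]]
    by (simp add: scaleR_fun_def)
qed

lemma vector_fields_zero: "0 \<in> vector_fields A"
  by (rule vector_fieldsI) (simp_all add: subspace_0 subspace_tangent_space smooth_functions_const)

lemma vector_fields_sum:
  assumes "finite I" "\<And>i. i \<in> I \<Longrightarrow> X i \<in> vector_fields A"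
  shows "(\<Sum>i\<in>I. X i) \<in> vector_fields A"
  using assms by (induction I rule: finite_induct) (auto intro: vector_fields_add vector_fields_zero)

text \<open>The vector field \<open>b \<partial>\<^sub>w\<close> in the chart \<open>c\<close>. It vanishes on functions that are not smooth
  because tangent vectors are normalised in this way.\<close>

definition chart_field ::
  "'a set \<Rightarrow> ('a \<Rightarrow> 'e) \<Rightarrow> ('e \<Rightarrow> real) \<Rightarrow> 'e \<Rightarrow> 'a vfield" where
  "chart_field U c b w q f = (if q \<in> U \<and> f \<in> smooth_functions A
     then b (c q) * frechet_derivative (f \<circ> inv_into U c) (at (c q)) w else 0)"

lemma chart_field_mem:
  assumes U: "(U, c) \<in> A" and K: "compact K" "K \<subseteq> c ` U"
    and b: "smooth_on (c ` U) b" "\<And>x. x \<in> c ` U \<Longrightarrow> x \<notin> K \<Longrightarrow> b x = 0"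
  shows "chart_field U c b w \<in> vector_fields A"
proof (rule vector_fieldsI)
  fix f assume f: "f \<in> smooth_functions A"
  have "(\<lambda>q. if q \<in> U then b (c q) * frechet_derivative (f \<circ> inv_into U c) (at (c q)) w else 0)
      \<in> smooth_functions A"
    using b(2) by (intro smooth_function_from_chart[OF U K smooth_on_mult[OF chart_image_open[OF U] b(1)
        smooth_on_frechet_derivative[OF smooth_functionsD[OF f U], of w]]]) simp
  then show "(\<lambda>q. chart_field U c b w q f) \<in> smooth_functions A"
    using f by (simp add: chart_field_def cong: if_cong)
next
  fix q
  show "chart_field U c b w q \<in> tangent_space A q"
  proof (cases "q \<in> U")
    case False
    then have "chart_field U c b w q = 0" by (simp add: chart_field_def fun_eq_iff)
    then show ?thesis using subspace_0[OF subspace_tangent_space] by simp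
  next
    case True
    let ?D = "\<lambda>f. frechet_derivative (f \<circ> inv_into U c) (at (c q))"
    have d: "((f \<circ> inv_into U c) has_derivative ?D f) (at (c q))" if "f \<in> smooth_functions A" for f
      using smooth_on_has_derivative[OF smooth_functionsD[OF that U]] True by blast
    have q: "inv_into U c (c q) = q" by (rule chart_inverse[OF U True])
    show ?thesis
    proof (rule tangent_spaceI)
      fix f h assume fh: "f \<in> smooth_functions A" "h \<in> smooth_functions A"
      have "((\<lambda>q. f q + h q) \<circ> inv_into U c has_derivative (\<lambda>w. ?D f w + ?D h w)) (at (c q))"
        using has_derivative_add[OF d[OF fh(1)] d[OF fh(2)]] by (simp add: comp_def)
      from frechet_derivative_at[OF this, symmetric]
      show "chart_field U c b w q (\<lambda>q. f q + h q) = chart_field U c b w q f + chart_field U c b w q h"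
        using fh True by (simp add: chart_field_def smooth_functions_add distrib_left)
      have "((\<lambda>q. f q * h q) \<circ> inv_into U c has_derivative (\<lambda>w. f q * ?D h w + ?D f w * h q)) (at (c q))"
        using has_derivative_mult[OF d[OF fh(1)] d[OF fh(2)]] by (simp add: comp_def q)
      from frechet_derivative_at[OF this, symmetric]
      show "chart_field U c b w q (\<lambda>q. f q * h q)
          = f q * chart_field U c b w q h + h q * chart_field U c b w q f"
        using fh True by (simp add: chart_field_def smooth_functions_mult algebra_simps)
    next
      fix a f assume f: "f \<in> smooth_functions A"
      have "((\<lambda>q. a * f q) \<circ> inv_into U c has_derivative (\<lambda>w. a * ?D f w)) (at (c q))"
        using has_derivative_mult_right[OF d[OF f], of a] by (simp add: comp_def)
      from frechet_derivative_at[OF this, symmetric]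
      show "chart_field U c b w q (\<lambda>q. a * f q) = a * chart_field U c b w q f"
        using f True by (simp add: chart_field_def smooth_functions_mult smooth_functions_const)
    qed (simp add: chart_field_def)
  qed
qed

text \<open>The fields are \<open>E\<^sub>i = B \<partial>\<^sub>i\<close> with a bump function \<open>B\<close>. The coordinates \<open>c\<^sub>i\<close> are not globally
  smooth functions, but \<open>u\<^sub>i = B c\<^sub>i\<close> are, and by the product rule
  \<open>B v(u\<^sub>i) - u\<^sub>i v(B)\<close> is \<open>B\<^sup>2 v(c\<^sub>i)\<close> where \<open>B \<noteq> 0\<close>; this is the coefficient \<open>\<theta>\<^sub>i(v)\<close>. It takes
  the value \<open>B\<^sup>3\<close> or \<open>0\<close> on \<open>E\<^sub>j\<close>, and the hypothesis on the dimension turns this duality into an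
  expansion of all tangent vectors, multiplied by \<open>b = B\<^sup>3\<close> so that it holds everywhere.\<close>

lemma local_frame:
  assumes dim: "\<And>q. \<exists>S. finite S \<and> independent S \<and> card S = DIM('e) \<and> span S = tangent_space A q"
  obtains b E \<theta> where "b p \<noteq> 0" "b \<in> smooth_functions A"
    "\<forall>i\<in>Basis. E i \<in> vector_fields A"
    "\<forall>i\<in>Basis. \<forall>X\<in>vector_fields A. (\<lambda>q. \<theta> i q (X q)) \<in> smooth_functions A"
    "\<forall>i q. \<theta> i q 0 = 0"
    "\<forall>q. \<forall>v\<in>tangent_space A q. b q *\<^sub>R v = (\<Sum>i\<in>(Basis :: 'e set). \<theta> i q v *\<^sub>R E i q)"
proof -
  have "p \<in> (\<Union>(U, c)\<in>A. U)" using charts_cover by simp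
  then obtain U c where U: "(U, c) \<in> A" and p: "p \<in> U" by blast
  note cU = chart_image_open[OF U]
  obtain r where r: "r > 0" "cball (c p) r \<subseteq> c ` U"
    using cU p open_contains_cball by blast
  obtain \<beta> :: "'e \<Rightarrow> real" where \<beta>: "smooth_on UNIV \<beta>" "\<beta> (c p) \<noteq> 0"
    "\<And>x. x \<notin> cball (c p) r \<Longrightarrow> \<beta> x = 0"
    using smooth_bump_exists[OF r(1)] by blast
  have \<beta>U: "smooth_on (c ` U) \<beta>" by (rule smooth_on_subset[OF \<beta>(1)]) simp
  define u where "u i q = (if q \<in> U then \<beta> (c q) * (c q \<bullet> i) else 0)" for i q
  define B where "B q = (if q \<in> U then \<beta> (c q) else 0)" for q
  define E where "E = chart_field U c \<beta>"
  have uS: "u i \<in> smooth_functions A" for i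
    unfolding u_def using smooth_on_mult[OF cU \<beta>U smooth_on_inner[OF cU]] \<beta>(3)
    by (intro smooth_function_from_chart[OF U compact_cball r(2)]) auto
  have BS: "B \<in> smooth_functions A"
    unfolding B_def by (rule smooth_function_from_chart[OF U compact_cball r(2) \<beta>U \<beta>(3)])
  have E: "E i \<in> vector_fields A" for i
    unfolding E_def by (rule chart_field_mem[OF U compact_cball r(2) \<beta>U \<beta>(3)])
  define \<theta> where "\<theta> i q v = B q * v (u i) - u i q * v B" for i q and v :: "'a tvec"
  have frame: "B q ^ 3 *\<^sub>R v = (\<Sum>i\<in>Basis. \<theta> i q v *\<^sub>R E i q)" if v: "v \<in> tangent_space A q" for q v
  proof (cases "B q = 0")
    case True
    then have "E i q = 0" for i
      by (auto simp: E_def chart_field_def B_def fun_eq_iff split: if_splits)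
    then show ?thesis using True by simp
  next
    case False
    then have q: "q \<in> U" "\<beta> (c q) \<noteq> 0" by (auto simp: B_def split: if_splits)
    have cq: "c q \<in> c ` U" using q by blast
    note d\<beta> = smooth_on_has_derivative[OF \<beta>U cq]
    have dB: "(B \<circ> inv_into U c has_derivative frechet_derivative \<beta> (at (c q))) (at (c q))"
      by (rule has_derivative_transform_within_open[OF d\<beta> cU cq])
        (use chart_inverse[OF U] in \<open>auto simp: B_def\<close>)
    have "((\<lambda>x. \<beta> x * (x \<bullet> i)) has_derivative
        (\<lambda>w. \<beta> (c q) * (w \<bullet> i) + frechet_derivative \<beta> (at (c q)) w * (c q \<bullet> i))) (at (c q))" for i
      by (rule has_derivative_mult[OF d\<beta>]) (auto intro!: derivative_eq_intros)
    then have du: "(u i \<circ> inv_into U c has_derivative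
        (\<lambda>w. \<beta> (c q) * (w \<bullet> i) + frechet_derivative \<beta> (at (c q)) w * (c q \<bullet> i))) (at (c q))" for i
      by (rule has_derivative_transform_within_open[OF _ cU cq])
        (use chart_inverse[OF U] in \<open>auto simp: u_def\<close>)
    have dual: "\<theta> j q (E i q) = (if i = j then B q ^ 3 else 0)" if "i \<in> Basis" "j \<in> Basis" for i j
      using q that inner_Basis[OF that]
      by (simp add: \<theta>_def E_def chart_field_def uS BS frechet_derivative_at[OF du, symmetric]
          frechet_derivative_at[OF dB, symmetric] u_def B_def power3_eq_cube algebra_simps)
    obtain S where S: "finite S" "independent S" "card S = DIM('e)" "span S = tangent_space A q"
      using dim by blast
    have "linear (\<theta> j q)" for j
      by (rule linearI) (simp_all add: \<theta>_def scaleR_fun_def algebra_simps)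
    moreover have "(\<lambda>i. E i q) ` Basis \<subseteq> span S"
      using vector_field_tangent[OF E] S(4) by auto
    ultimately show ?thesis
      using dual_family_expansion[OF finite_Basis S(1,2,3), of "\<lambda>i. E i q" "\<lambda>j. \<theta> j q" "B q ^ 3" v] dual v S(4) False
      by simp
  qed
  have \<theta>S: "(\<lambda>q. \<theta> i q (X q)) \<in> smooth_functions A" if "X \<in> vector_fields A" for i X
    unfolding \<theta>_def
    by (intro smooth_functions_diff smooth_functions_mult BS uS vector_field_smooth[OF that])
  have b: "(\<lambda>q. B q ^ 3) \<in> smooth_functions A"
    unfolding power3_eq_cube by (intro smooth_functions_mult BS)
  have "B p ^ 3 \<noteq> 0" using p \<beta>(2) by (simp add: B_def)
  moreover have "\<theta> i q 0 = 0" for i q by (simp add: \<theta>_def)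
  ultimately show ?thesis
    using that[of "\<lambda>q. B q ^ 3" E \<theta>] E \<theta>S b frame by simp
qed

end

section \<open>Extension of tangent vectors and tensoriality\<close>

context almost_contact_B_metric_manifold
begin

lemma tangent_basis:
  "\<exists>S. finite S \<and> independent S \<and> card S = DIM('e) \<and> span S = tangent_space A q"
proof -
  obtain P N where "finite P" "finite N" "card P = n + 1" "card N = n" "P \<inter> N = {}"
    "independent (P \<union> N)" "span (P \<union> N) = tangent_space A q"
    using g_signature[of q] unfolding has_signature_def by metis
  then show ?thesis
    using dimension by (intro exI[of _ "P \<union> N"]) (simp add: card_Un_disjoint)
qed

lemma pointwise:
  "almost_contact_B_metric_space (tangent_space A p) n (\<phi> p) (\<xi> p) (\<eta> p) (g p)"
  by unfold_locales
    (rule n_ge_1 subspace_tangent_space phi_linear phi_tangent vector_field_tangent[OF xi_smooth]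
      eta_linear g_bilinear g_signature phi_xi phi_phi eta_phi eta_xi g_phi_phi; assumption)+

text \<open>Freeze the coefficients of \<open>v\<close> in a frame at \<open>p\<close>.\<close>

lemma extension:
  assumes v: "v \<in> tangent_space A p"
  shows "extension A p v \<in> vector_fields A" "extension A p v p = v"
proof -
  obtain b E \<theta> where b: "b p \<noteq> 0" and E: "\<forall>i\<in>Basis. E i \<in> vector_fields A"
    and fr: "\<forall>q. \<forall>v\<in>tangent_space A q. b q *\<^sub>R v = (\<Sum>i\<in>(Basis :: 'e set). \<theta> i q v *\<^sub>R E i q)"
    by (rule local_frame[OF tangent_basis, where p = p])
  define X where "X = (\<Sum>i\<in>Basis. (\<lambda>q. (\<theta> i p v / b p) *\<^sub>R E i q))"
  have "X \<in> vector_fields A"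
    unfolding X_def by (intro vector_fields_sum vector_fields_scale smooth_functions_const) (use E in auto)
  moreover have "X p = v"
  proof -
    have "X p = (\<Sum>i\<in>Basis. (\<theta> i p v / b p) *\<^sub>R E i p)"
      unfolding X_def by (induction rule: infinite_finite_induct) auto
    also have "\<dots> = inverse (b p) *\<^sub>R (\<Sum>i\<in>Basis. \<theta> i p v *\<^sub>R E i p)"
      by (simp add: scaleR_sum_right divide_inverse mult.commute)
    also have "(\<Sum>i\<in>Basis. \<theta> i p v *\<^sub>R E i p) = b p *\<^sub>R v" using fr v by simp
    also have "inverse (b p) *\<^sub>R b p *\<^sub>R v = v" using b by simp
    finally show ?thesis .
  qed
  ultimately have "extension A p v \<in> vector_fields A \<and> extension A p v p = v"
    unfolding extension_def by (intro someI[of "\<lambda>X. X \<in> vector_fields A \<and> X p = v" X]) simp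
  then show "extension A p v \<in> vector_fields A" "extension A p v p = v" by auto
qed

text \<open>Multiplied by the cut-off function \<open>b\<close>, the field \<open>X\<close> is a combination of the frame
  fields with smooth coefficients that vanish at \<open>p\<close>. So a \<open>C\<^sup>\<infinity>\<close>-linear map kills it at \<open>p\<close>.\<close>

lemma tensorial_zero:
  fixes S :: "'a vfield \<Rightarrow> 'v::real_vector"
  assumes add: "\<And>X Y. X \<in> vector_fields A \<Longrightarrow> Y \<in> vector_fields A \<Longrightarrow> S (X + Y) = S X + S Y"
    and scale: "\<And>f X. f \<in> smooth_functions A \<Longrightarrow> X \<in> vector_fields A \<Longrightarrow>
      S (\<lambda>q. f q *\<^sub>R X q) = f p *\<^sub>R S X"
    and X: "X \<in> vector_fields A" "X p = 0"
  shows "S X = 0"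
proof -
  obtain b E \<theta> where b: "b p \<noteq> 0" "b \<in> smooth_functions A"
    and E: "\<forall>i\<in>Basis. E i \<in> vector_fields A"
    and \<theta>: "\<forall>i\<in>Basis. \<forall>X\<in>vector_fields A. (\<lambda>q. \<theta> i q (X q)) \<in> smooth_functions A"
      "\<forall>i q. \<theta> i q 0 = 0"
    and fr: "\<forall>q. \<forall>v\<in>tangent_space A q. b q *\<^sub>R v = (\<Sum>i\<in>(Basis :: 'e set). \<theta> i q v *\<^sub>R E i q)"
    by (rule local_frame[OF tangent_basis, where p = p])
  let ?Y = "\<lambda>i q. \<theta> i q (X q) *\<^sub>R E i q"
  have Y: "?Y i \<in> vector_fields A" if "i \<in> Basis" for i
    using that E \<theta>(1) X(1) by (intro vector_fields_scale) auto
  have S0: "S 0 = 0"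
    using add[OF vector_fields_zero vector_fields_zero] by simp
  have "(\<lambda>q. b q *\<^sub>R X q) = (\<Sum>i\<in>Basis. ?Y i)"
  proof
    fix q
    have "(\<Sum>i\<in>I. ?Y i) q = (\<Sum>i\<in>I. ?Y i q)" for I
      by (induction I rule: infinite_finite_induct) auto
    then show "b q *\<^sub>R X q = (\<Sum>i\<in>Basis. ?Y i) q"
      using fr vector_field_tangent[OF X(1)] by simp
  qed
  then have "b p *\<^sub>R S X = S (\<Sum>i\<in>Basis. ?Y i)"
    using scale[OF b(2) X(1)] by simp
  also have "\<dots> = (\<Sum>i\<in>Basis. S (?Y i))"
    using finite_Basis Y
  proof (induction rule: finite_induct)
    case (insert i I)
    have "(\<Sum>j\<in>I. ?Y j) \<in> vector_fields A"
      using insert by (intro vector_fields_sum) auto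
    then have "S (?Y i + (\<Sum>j\<in>I. ?Y j)) = S (?Y i) + S (\<Sum>j\<in>I. ?Y j)"
      using insert by (intro add) auto
    moreover have "S (\<Sum>j\<in>I. ?Y j) = (\<Sum>j\<in>I. S (?Y j))"
      using insert by auto
    ultimately show ?case unfolding sum.insert[OF insert(1,2)] by (simp only:)
  qed (simp add: S0)
  also have "(\<Sum>i\<in>Basis. S (?Y i)) = (\<Sum>i\<in>Basis. \<theta> i p (X p) *\<^sub>R S (E i))"
    by (intro sum.cong refl scale) (use E \<theta>(1) X(1) in auto)
  finally show ?thesis using b(1) \<theta>(2) X(2) by simp
qed

lemma tensorial:
  fixes S :: "'a vfield \<Rightarrow> 'v::real_vector"
  assumes add: "\<And>X Y. X \<in> vector_fields A \<Longrightarrow> Y \<in> vector_fields A \<Longrightarrow> S (X + Y) = S X + S Y"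
    and scale: "\<And>f X. f \<in> smooth_functions A \<Longrightarrow> X \<in> vector_fields A \<Longrightarrow>
      S (\<lambda>q. f q *\<^sub>R X q) = f p *\<^sub>R S X"
    and X: "X \<in> vector_fields A" and Y: "Y \<in> vector_fields A" and eq: "X p = Y p"
  shows "S X = S Y"
proof -
  have mY: "(\<lambda>q. (-1) *\<^sub>R Y q) \<in> vector_fields A"
    by (rule vector_fields_scale[OF smooth_functions_const Y])
  have "S (X + (\<lambda>q. (-1) *\<^sub>R Y q)) = 0"
    by (rule tensorial_zero[OF add scale vector_fields_add[OF X mY]]) (simp_all add: eq)
  then show ?thesis using add[OF X mY] scale[OF smooth_functions_const Y, of "-1"] by simp
qed

section \<open>The covariant derivative of \<open>\<phi>\<close> and parallel \<open>\<xi>\<close>\<close>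

context
  fixes nabla :: "'a vfield \<Rightarrow> 'a vfield \<Rightarrow> 'a vfield"
  assumes LC: "is_levi_civita A g nabla"
begin

lemma nabla_rules:
  assumes "X \<in> vector_fields A" "Y \<in> vector_fields A"
  shows nabla_mem: "nabla X Y \<in> vector_fields A"
    and nabla_add1: "Z \<in> vector_fields A \<Longrightarrow> nabla (X + Y) Z = nabla X Z + nabla Y Z"
    and nabla_add2: "Z \<in> vector_fields A \<Longrightarrow> nabla Z (X + Y) = nabla Z X + nabla Z Y"
    and nabla_scale1: "f \<in> smooth_functions A \<Longrightarrow> nabla (\<lambda>p. f p *\<^sub>R X p) Y = (\<lambda>p. f p *\<^sub>R nabla X Y p)"
    and nabla_scale2: "f \<in> smooth_functions A \<Longrightarrow>
      nabla X (\<lambda>p. f p *\<^sub>R Y p) = (\<lambda>p. X p f *\<^sub>R Y p + f p *\<^sub>R nabla X Y p)"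
    and nabla_metric: "Z \<in> vector_fields A \<Longrightarrow>
      X p (\<lambda>q. g q (Y q) (Z q)) = g p (nabla X Y p) (Z p) + g p (Y p) (nabla X Z p)"
  using LC assms unfolding is_levi_civita_def is_connection_def by simp_all

lemma nabla_zero: "X \<in> vector_fields A \<Longrightarrow> nabla X 0 = 0"
  using nabla_add2[OF vector_fields_zero vector_fields_zero, of X] by simp

lemma nabla_tangent [simp]:
  "X \<in> vector_fields A \<Longrightarrow> Y \<in> vector_fields A \<Longrightarrow> nabla X Y p \<in> tangent_space A p"
  by (rule vector_field_tangent[OF nabla_mem])

lemma derivative_const:
  assumes X: "X \<in> vector_fields A"
  shows "X p (\<lambda>q. a) = 0"
proof -
  have "\<forall>f\<in>smooth_functions A. \<forall>h\<in>smooth_functions A. X p (\<lambda>q. f q * h q) = f p * X p h + h p * X p f"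
    and scale: "\<forall>a. \<forall>f\<in>smooth_functions A. X p (\<lambda>q. a * f q) = a * X p f"
    using vector_field_tangent[OF X, of p] unfolding tangent_space_def by simp_all
  from bspec[OF bspec[OF this(1) smooth_functions_const[of 1]] smooth_functions_const[of 1]]
  have "X p (\<lambda>q. 1) = 0" by simp
  then show ?thesis using bspec[OF spec[OF scale, of a] smooth_functions_const[of 1]] by simp
qed

abbreviation Dphi where "Dphi X Y p \<equiv> cov_deriv_phi nabla \<phi> X Y p"

lemma Dphi_eq: "Dphi X Y p = nabla X (\<lambda>q. \<phi> q (Y q)) p - \<phi> p (nabla X Y p)"
  by (simp add: cov_deriv_phi_def)

lemma phi_add_field:
  "X \<in> vector_fields A \<Longrightarrow> Y \<in> vector_fields A \<Longrightarrow>
    (\<lambda>q. \<phi> q ((X + Y) q)) = (\<lambda>q. \<phi> q (X q)) + (\<lambda>q. \<phi> q (Y q))"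
  by (rule ext) (simp add: linear_on_add[OF phi_linear] vector_field_tangent)

lemma phi_scale_field:
  "X \<in> vector_fields A \<Longrightarrow> (\<lambda>q. \<phi> q (f q *\<^sub>R X q)) = (\<lambda>q. f q *\<^sub>R \<phi> q (X q))"
  by (rule ext) (simp add: linear_on_scaleR[OF phi_linear] vector_field_tangent)

lemma Dphi_linear:
  assumes X: "X \<in> vector_fields A" and Y: "Y \<in> vector_fields A"
  shows Dphi_add1: "Z \<in> vector_fields A \<Longrightarrow> Dphi (X + Z) Y p = Dphi X Y p + Dphi Z Y p"
    and Dphi_add2: "Z \<in> vector_fields A \<Longrightarrow> Dphi X (Y + Z) p = Dphi X Y p + Dphi X Z p"
    and Dphi_scale1: "f \<in> smooth_functions A \<Longrightarrow> Dphi (\<lambda>q. f q *\<^sub>R X q) Y p = f p *\<^sub>R Dphi X Y p"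
    and Dphi_scale2: "f \<in> smooth_functions A \<Longrightarrow> Dphi X (\<lambda>q. f q *\<^sub>R Y q) p = f p *\<^sub>R Dphi X Y p"
proof -
  note phi = linear_on_add[OF phi_linear] linear_on_scaleR[OF phi_linear]
  show "Dphi (X + Z) Y p = Dphi X Y p + Dphi Z Y p" if "Z \<in> vector_fields A"
    using X Y that by (simp add: Dphi_eq nabla_add1 phi_smooth phi)
  show "Dphi X (Y + Z) p = Dphi X Y p + Dphi X Z p" if Z: "Z \<in> vector_fields A"
    using X Y Z unfolding Dphi_eq phi_add_field[OF Y Z] by (simp add: nabla_add2 phi_smooth phi)
  show "Dphi (\<lambda>q. f q *\<^sub>R X q) Y p = f p *\<^sub>R Dphi X Y p" if "f \<in> smooth_functions A"
    using X Y that by (simp add: Dphi_eq nabla_scale1 phi_smooth phi scaleR_diff_right)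
  show "Dphi X (\<lambda>q. f q *\<^sub>R Y q) p = f p *\<^sub>R Dphi X Y p" if "f \<in> smooth_functions A"
    using X Y that unfolding Dphi_eq phi_scale_field[OF Y]
    by (simp add: nabla_scale2 phi_smooth phi scaleR_diff_right
        subspace_add subspace_scale subspace_tangent_space vector_field_tangent)
qed

lemma Dphi_tensorial:
  assumes "X \<in> vector_fields A" "X' \<in> vector_fields A" "Y \<in> vector_fields A" "Y' \<in> vector_fields A"
    and "X p = X' p" "Y p = Y' p"
  shows "Dphi X Y p = Dphi X' Y' p"
proof -
  have "Dphi X Y p = Dphi X' Y p"
    by (rule tensorial[where S = "\<lambda>X. Dphi X Y p", OF _ _ assms(1,2,5)])
      (simp_all add: Dphi_add1 Dphi_scale1 assms(3))
  also have "Dphi X' Y p = Dphi X' Y' p"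
    by (rule tensorial[where S = "\<lambda>Y. Dphi X' Y p", OF _ _ assms(3,4,6)])
      (simp_all add: Dphi_add2 Dphi_scale2 assms(2))
  finally show ?thesis .
qed

abbreviation Ft where "Ft \<equiv> fundamental_tensor A \<phi> g nabla"

lemma fundamental_tensor_eq:
  assumes "X \<in> vector_fields A" "Y \<in> vector_fields A" "z \<in> tangent_space A p"
  shows "Ft p (X p) (Y p) z = g p (Dphi X Y p) z"
proof -
  have "X p \<in> tangent_space A p" "Y p \<in> tangent_space A p"
    using assms by (auto intro: vector_field_tangent)
  moreover from this have "Dphi (extension A p (X p)) (extension A p (Y p)) p = Dphi X Y p"
    by (intro Dphi_tensorial extension assms)
  ultimately show ?thesis using assms(3) by (simp add: fundamental_tensor_def)
qed

lemma Dphi_tangent [simp]: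
  "X \<in> vector_fields A \<Longrightarrow> Y \<in> vector_fields A \<Longrightarrow> Dphi X Y p \<in> tangent_space A p"
  by (simp add: Dphi_eq subspace_diff subspace_tangent_space phi_smooth phi_tangent)

text \<open>Differentiate \<open>g(\<phi>Y, Z) = g(\<phi>Z, Y)\<close>.\<close>

lemma Dphi_symmetric:
  assumes X: "X \<in> vector_fields A" and Y: "Y \<in> vector_fields A" and Z: "Z \<in> vector_fields A"
  shows "g p (Dphi X Y p) (Z p) = g p (Dphi X Z p) (Y p)"
proof -
  interpret I: almost_contact_B_metric_space "tangent_space A s" n "\<phi> s" "\<xi> s" "\<eta> s" "g s" for s
    by (rule pointwise)
  note t = vector_field_tangent[OF X] vector_field_tangent[OF Y] vector_field_tangent[OF Z]
  have diff: "g p (u - v) w = g p u w - g p v w"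
    if "u \<in> tangent_space A p" "v \<in> tangent_space A p" "w \<in> tangent_space A p" for u v w
    using I.g_add_left[of w p u "- v"] I.g_minus_left[of v p w] that by simp
  have "g q (\<phi> q (Y q)) (Z q) = g q (\<phi> q (Z q)) (Y q)" for q
    using t I.g_phi[of "Y q" q "Z q"] I.g_commute[of "Y q" q "\<phi> q (Z q)"] by simp
  then have "X p (\<lambda>q. g q (\<phi> q (Y q)) (Z q)) = X p (\<lambda>q. g q (\<phi> q (Z q)) (Y q))" by simp
  then have "g p (nabla X (\<lambda>q. \<phi> q (Y q)) p) (Z p) + g p (\<phi> p (Y p)) (nabla X Z p)
      = g p (nabla X (\<lambda>q. \<phi> q (Z q)) p) (Y p) + g p (\<phi> p (Z p)) (nabla X Y p)"
    using nabla_metric[OF X phi_smooth[OF Y] Z, of p] nabla_metric[OF X phi_smooth[OF Z] Y, of p] by simp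
  moreover have "g p (\<phi> p (nabla X Y p)) (Z p) = g p (\<phi> p (Z p)) (nabla X Y p)"
    "g p (\<phi> p (nabla X Z p)) (Y p) = g p (\<phi> p (Y p)) (nabla X Z p)"
    using t X Y Z I.g_phi[of "nabla X Y p" p "Z p"] I.g_commute[of "nabla X Y p" p "\<phi> p (Z p)"]
      I.g_phi[of "nabla X Z p" p "Y p"] I.g_commute[of "nabla X Z p" p "\<phi> p (Y p)"] by simp_all
  ultimately show ?thesis
    using t X Y Z by (simp add: Dphi_eq diff phi_smooth)
qed

text \<open>Differentiate \<open>g(\<xi>, \<xi>) = 1\<close>.\<close>

lemma nabla_xi_horizontal:
  assumes X: "X \<in> vector_fields A"
  shows "\<eta> p (nabla X \<xi> p) = 0"
proof -
  interpret I: almost_contact_B_metric_space "tangent_space A s" n "\<phi> s" "\<xi> s" "\<eta> s" "g s" for s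
    by (rule pointwise)
  have "g q (\<xi> q) (\<xi> q) = 1" for q by (simp add: I.g_xi)
  then have "X p (\<lambda>q. g q (\<xi> q) (\<xi> q)) = 0" using derivative_const[OF X, of p 1] by simp
  then have "g p (nabla X \<xi> p) (\<xi> p) + g p (\<xi> p) (nabla X \<xi> p) = 0"
    using nabla_metric[OF X xi_smooth xi_smooth, of p] by simp
  moreover have "g p (nabla X \<xi> p) (\<xi> p) = \<eta> p (nabla X \<xi> p)"
    "g p (\<xi> p) (nabla X \<xi> p) = \<eta> p (nabla X \<xi> p)"
    using X xi_smooth by (simp_all add: I.g_xi I.g_xi')
  ultimately show ?thesis by simp
qed

lemma Dphi_xi: "X \<in> vector_fields A \<Longrightarrow> Dphi X \<xi> p = - \<phi> p (nabla X \<xi> p)"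
proof -
  assume X: "X \<in> vector_fields A"
  have "(\<lambda>q. \<phi> q (\<xi> q)) = 0" by (rule ext) (simp add: phi_xi)
  then show ?thesis using nabla_zero[OF X] by (simp add: Dphi_eq)
qed

text \<open>Differentiate \<open>\<phi>\<^sup>2 Y = - Y + \<eta>(Y) \<xi>\<close>.\<close>

lemma Dphi_phi:
  assumes X: "X \<in> vector_fields A" and Y: "Y \<in> vector_fields A"
  shows "Dphi X (\<lambda>q. \<phi> q (Y q)) p + \<phi> p (Dphi X Y p)
    = (X p (\<lambda>q. \<eta> q (Y q)) - \<eta> p (nabla X Y p)) *\<^sub>R \<xi> p + \<eta> p (Y p) *\<^sub>R nabla X \<xi> p"
proof -
  interpret I: almost_contact_B_metric_space "tangent_space A s" n "\<phi> s" "\<xi> s" "\<eta> s" "g s" for s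
    by (rule pointwise)
  have eY: "(\<lambda>q. \<eta> q (Y q)) \<in> smooth_functions A" by (rule eta_smooth[OF Y])
  have "(\<lambda>q. \<phi> q (\<phi> q (Y q))) = (\<lambda>q. (-1) *\<^sub>R Y q) + (\<lambda>q. \<eta> q (Y q) *\<^sub>R \<xi> q)"
    by (rule ext) (simp add: phi_phi vector_field_tangent[OF Y])
  then have "nabla X (\<lambda>q. \<phi> q (\<phi> q (Y q))) p
      = - nabla X Y p + X p (\<lambda>q. \<eta> q (Y q)) *\<^sub>R \<xi> p + \<eta> p (Y p) *\<^sub>R nabla X \<xi> p"
    using nabla_add2[OF vector_fields_scale[OF smooth_functions_const Y] vector_fields_scale[OF eY xi_smooth] X, of "-1"]
      nabla_scale2[OF X Y smooth_functions_const, of "-1"] nabla_scale2[OF X xi_smooth eY] derivative_const[OF X]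
    by simp
  moreover have "Dphi X (\<lambda>q. \<phi> q (Y q)) p
      = nabla X (\<lambda>q. \<phi> q (\<phi> q (Y q))) p - \<phi> p (nabla X (\<lambda>q. \<phi> q (Y q)) p)"
    by (rule Dphi_eq)
  moreover have "\<phi> p (Dphi X Y p) = \<phi> p (nabla X (\<lambda>q. \<phi> q (Y q)) p) - \<phi> p (\<phi> p (nabla X Y p))"
    using I.phi_add[of "nabla X (\<lambda>q. \<phi> q (Y q)) p" p "- \<phi> p (nabla X Y p)"]
      I.phi_minus[of "\<phi> p (nabla X Y p)" p] X Y
    by (simp add: Dphi_eq phi_smooth)
  ultimately show ?thesis
    using X Y by (simp add: phi_phi scaleR_diff_left)
qed

text \<open>The last identity of a tensor of type F comes from pairing \<open>Dphi_phi\<close> with \<open>\<phi>z\<close>: the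
  multiple of \<open>\<xi>\<close> disappears and \<open>g(\<nabla>\<^sub>x\<xi>, \<phi>z)\<close> is \<open>- F(x, \<xi>, z)\<close>.\<close>

lemma fundamental_tensor_mem:
  "Ft p \<in> F_tensors (tangent_space A p) (\<phi> p) (\<xi> p) (\<eta> p)"
proof -
  interpret I: almost_contact_B_metric_space "tangent_space A p" n "\<phi> p" "\<xi> p" "\<eta> p" "g p"
    by (rule pointwise)
  note ext = extension
  let ?V = "tangent_space A p" and ?e = "extension A p"
  have F: "Ft p x y z = g p (Dphi (?e x) (?e y) p) z" if "x \<in> ?V" "y \<in> ?V" "z \<in> ?V" for x y z
    using that by (simp add: fundamental_tensor_def)
  show ?thesis
  proof (rule I.F_tensorsI)
    show "Ft p x y z = 0" if "\<not> (x \<in> ?V \<and> y \<in> ?V \<and> z \<in> ?V)" for x y z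
      using that by (auto simp: fundamental_tensor_def)
    show "linear_on ?V (Ft p x y)" if "x \<in> ?V" "y \<in> ?V" for x y
      unfolding linear_on_def using that
      by (simp add: F I.g_add_right I.g_scaleR_right ext)
    show "linear_on ?V (\<lambda>x. Ft p x y z)" if yz: "y \<in> ?V" "z \<in> ?V" for y z
      unfolding linear_on_def
    proof (intro conjI ballI allI)
      fix x x' assume x: "x \<in> ?V" "x' \<in> ?V"
      have "Ft p ((?e x + ?e x') p) (?e y p) z = Ft p (?e x p) (?e y p) z + Ft p (?e x' p) (?e y p) z"
        unfolding fundamental_tensor_eq[OF vector_fields_add[OF ext(1)[OF x(1)] ext(1)[OF x(2)]] ext(1)[OF yz(1)] yz(2)]
          fundamental_tensor_eq[OF ext(1)[OF x(1)] ext(1)[OF yz(1)] yz(2)]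
          fundamental_tensor_eq[OF ext(1)[OF x(2)] ext(1)[OF yz(1)] yz(2)]
        using x yz by (simp add: Dphi_add1 ext I.g_add_left)
      then show "Ft p (x + x') y z = Ft p x y z + Ft p x' y z" using x yz by (simp add: ext)
    next
      fix a x assume x: "x \<in> ?V"
      have "Ft p (a *\<^sub>R ?e x p) (?e y p) z = a * Ft p (?e x p) (?e y p) z"
        unfolding fundamental_tensor_eq[OF vector_fields_scale[OF smooth_functions_const ext(1)[OF x]] ext(1)[OF yz(1)] yz(2)]
          fundamental_tensor_eq[OF ext(1)[OF x] ext(1)[OF yz(1)] yz(2)]
        using x yz by (simp add: Dphi_scale1 smooth_functions_const ext I.g_scaleR_left)
      then show "Ft p (a *\<^sub>R x) y z = a *\<^sub>R Ft p x y z" using x yz by (simp add: ext)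
    qed
    fix x y z assume V: "x \<in> ?V" "y \<in> ?V" "z \<in> ?V"
    note E = ext(1)[OF V(1)] ext(1)[OF V(2)] ext(1)[OF V(3)]
    show "Ft p x y z = Ft p x z y"
      using Dphi_symmetric[OF E, of p] V by (simp add: F ext)
    let ?D = "Dphi (?e x) (?e y) p" and ?w = "nabla (?e x) \<xi> p"
    have D: "?D \<in> ?V" and w: "?w \<in> ?V" using E xi_smooth by simp_all
    have "Ft p (?e x p) ((\<lambda>q. \<phi> q (?e y q)) p) (\<phi> p z) = g p (Dphi (?e x) (\<lambda>q. \<phi> q (?e y q)) p) (\<phi> p z)"
      by (rule fundamental_tensor_eq) (use E V phi_smooth in auto)
    moreover have "Dphi (?e x) (\<lambda>q. \<phi> q (?e y q)) p
        = (?e x p (\<lambda>q. \<eta> q (?e y q)) - \<eta> p (nabla (?e x) (?e y) p)) *\<^sub>R \<xi> p + \<eta> p y *\<^sub>R ?w - \<phi> p ?D"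
      (is "_ = ?a *\<^sub>R \<xi> p + _ - _")
      using Dphi_phi[OF E(1,2), of p] V by (simp add: ext algebra_simps)
    moreover have "g p (?a *\<^sub>R \<xi> p + \<eta> p y *\<^sub>R ?w - \<phi> p ?D) (\<phi> p z)
        = \<eta> p y * g p ?w (\<phi> p z) - g p (\<phi> p ?D) (\<phi> p z)"
      using I.g_add_left[of "\<phi> p z" "?a *\<^sub>R \<xi> p + \<eta> p y *\<^sub>R ?w" "- \<phi> p ?D"]
        I.g_add_left[of "\<phi> p z" "?a *\<^sub>R \<xi> p" "\<eta> p y *\<^sub>R ?w"]
        I.g_minus_left[of "\<phi> p ?D" "\<phi> p z"] I.g_scaleR_left[of "\<phi> p z" "\<xi> p" ?a]
        I.g_scaleR_left[of "\<phi> p z" ?w "\<eta> p y"] D w V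
      by (simp add: I.g_xi')
    moreover have "g p (\<phi> p ?D) (\<phi> p z) = - g p ?D z + g p ?D (\<xi> p) * \<eta> p z"
      using D V by (simp add: g_phi_phi I.g_xi)
    moreover have "Ft p x (\<xi> p) z = - g p ?w (\<phi> p z)"
      using fundamental_tensor_eq[OF E(1) xi_smooth V(3)] Dphi_xi[OF E(1), of p] V w
      by (simp add: ext I.g_minus_left I.g_phi)
    moreover have "Ft p x y z = g p ?D z" "Ft p x y (\<xi> p) = g p ?D (\<xi> p)"
      using V by (simp_all add: F)
    ultimately show "Ft p x y z = Ft p x (\<phi> p y) (\<phi> p z) + \<eta> p y * Ft p x (\<xi> p) z + \<eta> p z * Ft p x y (\<xi> p)"
      using V by (simp add: ext algebra_simps)
  qed
qed

text \<open>If \<open>F(x, \<xi>, z) = - g(\<phi>\<nabla>\<^sub>x\<xi>, z)\<close> vanishes for all \<open>z\<close>, then \<open>\<phi>\<nabla>\<^sub>x\<xi> = 0\<close>, and \<open>\<phi>\<^sup>2 = -1\<close> on the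
  horizontal vector \<open>\<nabla>\<^sub>x\<xi>\<close>.\<close>

lemma nabla_xi_zero_iff:
  "(\<forall>X\<in>vector_fields A. nabla X \<xi> = 0) \<longleftrightarrow>
   (\<forall>p. \<forall>x\<in>tangent_space A p. \<forall>z\<in>tangent_space A p. Ft p x (\<xi> p) z = 0)"
proof -
  interpret I: almost_contact_B_metric_space "tangent_space A s" n "\<phi> s" "\<xi> s" "\<eta> s" "g s" for s
    by (rule pointwise)
  have F: "Ft p (X p) (\<xi> p) z = - g p (\<phi> p (nabla X \<xi> p)) z"
    if "X \<in> vector_fields A" "z \<in> tangent_space A p" for X p z
    using fundamental_tensor_eq[OF that(1) xi_smooth that(2)] Dphi_xi[OF that(1), of p] that xi_smooth
    by (simp add: I.g_minus_left)
  show ?thesis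
  proof
    assume zero: "\<forall>X\<in>vector_fields A. nabla X \<xi> = 0"
    show "\<forall>p. \<forall>x\<in>tangent_space A p. \<forall>z\<in>tangent_space A p. Ft p x (\<xi> p) z = 0"
    proof (intro allI ballI)
      fix p x z assume V: "x \<in> tangent_space A p" "z \<in> tangent_space A p"
      then show "Ft p x (\<xi> p) z = 0"
        using F[OF extension(1)[OF V(1)] V(2)] zero extension[OF V(1)] by simp
    qed
  next
    assume vert: "\<forall>p. \<forall>x\<in>tangent_space A p. \<forall>z\<in>tangent_space A p. Ft p x (\<xi> p) z = 0"
    show "\<forall>X\<in>vector_fields A. nabla X \<xi> = 0"
    proof
      fix X assume X: "X \<in> vector_fields A"
      have "nabla X \<xi> p = 0" for p
      proof -
        let ?w = "nabla X \<xi> p"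
        have w: "?w \<in> tangent_space A p" using X xi_smooth by simp
        have "\<phi> p ?w = 0"
        proof (rule I.nondegenerate)
          show "\<phi> p ?w \<in> tangent_space A p" using w by simp
          fix z assume z: "z \<in> tangent_space A p"
          have "Ft p (X p) (\<xi> p) z = 0" using vert vector_field_tangent[OF X, of p] z by blast
          then show "g p (\<phi> p ?w) z = 0" using F[OF X z] by simp
        qed
        then have "- ?w + \<eta> p ?w *\<^sub>R \<xi> p = 0" using phi_phi[OF w] by simp
        then show ?thesis using nabla_xi_horizontal[OF X] by simp
      qed
      then show "nabla X \<xi> = 0" by (intro ext) simp
    qed
  qed
qed

text \<open>Testing \<open>D = \<nabla>\<close> on \<open>\<xi>\<close> suffices for one direction. For the other, \<open>\<nabla>\<^sub>X\<close> maps the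
  vertical part of \<open>Y\<close> to a multiple of \<open>\<xi>\<close> by the product rule, and the horizontal part to a
  horizontal field by differentiating \<open>g(Y\<^sup>h, \<xi>) = 0\<close>.\<close>

lemma schouten_van_kampen_eq_iff:
  "(\<forall>X\<in>vector_fields A. \<forall>Y\<in>vector_fields A. schouten_van_kampen \<xi> \<eta> nabla X Y = nabla X Y)
   \<longleftrightarrow> (\<forall>X\<in>vector_fields A. nabla X \<xi> = 0)"
proof -
  interpret I: almost_contact_B_metric_space "tangent_space A s" n "\<phi> s" "\<xi> s" "\<eta> s" "g s" for s
    by (rule pointwise)
  show ?thesis
  proof
    assume eq: "\<forall>X\<in>vector_fields A. \<forall>Y\<in>vector_fields A. schouten_van_kampen \<xi> \<eta> nabla X Y = nabla X Y"
    show "\<forall>X\<in>vector_fields A. nabla X \<xi> = 0"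
    proof
      fix X assume X: "X \<in> vector_fields A"
      have hv: "horizontal \<xi> \<eta> \<xi> = 0" "vertical \<xi> \<eta> \<xi> = \<xi>"
        by (rule ext, simp add: horizontal_def vertical_def)+
      have "schouten_van_kampen \<xi> \<eta> nabla X \<xi> = horizontal \<xi> \<eta> 0 + vertical \<xi> \<eta> (nabla X \<xi>)"
        unfolding schouten_van_kampen_def hv nabla_zero[OF X] ..
      also have "\<dots> = 0"
        by (rule ext) (simp add: horizontal_def vertical_def nabla_xi_horizontal[OF X])
      finally have "schouten_van_kampen \<xi> \<eta> nabla X \<xi> = 0" .
      then show "nabla X \<xi> = 0" using eq X xi_smooth by simp
    qed
  next
    assume zero: "\<forall>X\<in>vector_fields A. nabla X \<xi> = 0"
    show "\<forall>X\<in>vector_fields A. \<forall>Y\<in>vector_fields A. schouten_van_kampen \<xi> \<eta> nabla X Y = nabla X Y"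
    proof (intro ballI)
      fix X Y assume X: "X \<in> vector_fields A" and Y: "Y \<in> vector_fields A"
      let ?f = "\<lambda>q. \<eta> q (Y q)"
      define Yv where "Yv = vertical \<xi> \<eta> Y"
      define Yh where "Yh = horizontal \<xi> \<eta> Y"
      have f: "?f \<in> smooth_functions A" by (rule eta_smooth[OF Y])
      have Yv: "Yv \<in> vector_fields A"
        unfolding Yv_def vertical_def by (rule vector_fields_scale[OF f xi_smooth])
      have "Yh = Y + (\<lambda>q. (-1) *\<^sub>R Yv q)"
        by (rule ext) (simp add: Yh_def Yv_def horizontal_def vertical_def)
      then have Yh: "Yh \<in> vector_fields A"
        using vector_fields_add[OF Y vector_fields_scale[OF smooth_functions_const Yv]] by metis
      have "Y = Yh + Yv"
        by (rule ext) (simp add: Yh_def Yv_def horizontal_def vertical_def)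
      then have sum: "nabla X Y = nabla X Yh + nabla X Yv" using nabla_add2[OF Yh Yv X] by simp
      have v: "nabla X Yv p = X p ?f *\<^sub>R \<xi> p" for p
        using nabla_scale2[OF X xi_smooth f] zero X by (simp add: Yv_def vertical_def)
      have "\<eta> q (Yh q) = 0" for q
        using vector_field_tangent[OF Y, of q] I.eta_add[of "Y q" q "- (\<eta> q (Y q) *\<^sub>R \<xi> q)"]
          I.eta_scaleR[of "\<xi> q" q "- \<eta> q (Y q)"]
        by (simp add: Yh_def horizontal_def)
      then have "g q (Yh q) (\<xi> q) = 0" for q
        using vector_field_tangent[OF Yh, of q] by (simp add: I.g_xi)
      then have h: "\<eta> p (nabla X Yh p) = 0" for p
        using nabla_metric[OF X Yh xi_smooth, of p] derivative_const[OF X, of p 0] zero X Yh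
          vector_field_tangent[OF Yh, of p] by (simp add: I.g_xi)
      have "schouten_van_kampen \<xi> \<eta> nabla X Y p = nabla X Y p" for p
      proof -
        have "\<eta> p (X p ?f *\<^sub>R \<xi> p) = X p ?f" using I.eta_scaleR[of "\<xi> p" p] by simp
        then show ?thesis
          unfolding schouten_van_kampen_def Yv_def[symmetric] Yh_def[symmetric] sum
          by (simp add: horizontal_def vertical_def h v)
      qed
      then show "schouten_van_kampen \<xi> \<eta> nabla X Y = nabla X Y" by (rule ext)
    qed
  qed
qed

lemma U1_iff:
  "(\<forall>X\<in>vector_fields A. \<forall>Y\<in>vector_fields A. schouten_van_kampen \<xi> \<eta> nabla X Y = nabla X Y)
   \<longleftrightarrow> belongs_to_U1 A n \<phi> \<xi> \<eta> g nabla"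
  unfolding schouten_van_kampen_eq_iff nabla_xi_zero_iff belongs_to_U1_def
    almost_contact_B_metric_space.class_U1_iff[OF pointwise fundamental_tensor_mem] ..

end

end

theorem theorem3p2:
  fixes A :: "('a::{t2_space,second_countable_topology}, 'e::euclidean_space) chart set"
    and n :: nat
    and \<phi> :: "'a \<Rightarrow> 'a tvec \<Rightarrow> 'a tvec"
    and \<xi> :: "'a vfield"
    and \<eta> :: "'a \<Rightarrow> 'a tvec \<Rightarrow> real"
    and g :: "'a \<Rightarrow> 'a tvec \<Rightarrow> 'a tvec \<Rightarrow> real"
    and nabla :: "'a vfield \<Rightarrow> 'a vfield \<Rightarrow> 'a vfield"
  assumes "almost_contact_B_metric_manifold A n \<phi> \<xi> \<eta> g"
    and "is_levi_civita A g nabla"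
  shows "(\<forall>X\<in>vector_fields A. \<forall>Y\<in>vector_fields A.
            schouten_van_kampen \<xi> \<eta> nabla X Y = nabla X Y)
         \<longleftrightarrow> belongs_to_U1 A n \<phi> \<xi> \<eta> g nabla"
  by (rule almost_contact_B_metric_manifold.U1_iff[OF assms])

end
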